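(* For all sufficiently large positive integers $n$, $$4.434^n\leq 2^n\, r_3(\mathbb{Z}_3^n)\leq r_6(\mathbb{Z}_6^n)\leq 5.709^n.$$
   Context: Here $\mathbb{Z}_m^n := (\mathbb{Z}/m\mathbb{Z})^n$. A $k$-term arithmetic progression is a sequence $a, a+d, a+2d,\dots,a+(k-1)d$ with $a,d\in\mathbb{Z}_m^n$. $r_k(\mathbb{Z}_m^n)$ denotes the maximal size of a set $A\subseteq\mathbb{Z}_m^n$ containing no $k$ distinct elements in arithmetic progression, i.e. no $k$-term arithmetic progression whose $k$ terms are pairwise distinct. *)

theory Defs
  imports Complex_Main "HOL-Algebra.Product_Groups"
begin

text \<open>The library writes its groups multiplicatively, so \<open>a \<otimes> d [^] i\<close> is the
  mathematical \<open>a + i d\<close>.\<close>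

definition Zmn :: "nat \<Rightarrow> nat \<Rightarrow> (nat \<Rightarrow> int) monoid" where
  "Zmn m n = product_group {..<n} (\<lambda>_. integer_mod_group m)"

definition ap_term :: "('a, 'b) monoid_scheme \<Rightarrow> 'a \<Rightarrow> 'a \<Rightarrow> nat \<Rightarrow> 'a" where
  "ap_term G a d i = a \<otimes>\<^bsub>G\<^esub> (d [^]\<^bsub>G\<^esub> i)"

definition contains_ap :: "('a, 'b) monoid_scheme \<Rightarrow> nat \<Rightarrow> 'a set \<Rightarrow> bool" where
  "contains_ap G k A \<longleftrightarrow>
     (\<exists>a\<in>carrier G. \<exists>d\<in>carrier G.
        (\<forall>i<k. ap_term G a d i \<in> A) \<and> inj_on (ap_term G a d) {..<k})"

text \<open>Only meaningful for finite \<open>G\<close> and \<open>k > 0\<close>: otherwise the set under \<open>Max\<close> may be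
  infinite or empty.\<close>

definition r_ap :: "nat \<Rightarrow> ('a, 'b) monoid_scheme \<Rightarrow> nat" where
  "r_ap k G = Max {card A | A. A \<subseteq> carrier G \<and> \<not> contains_ap G k A}"

lemma carrier_Zmn:
  assumes "m > 0"
  shows "carrier (Zmn m n) = {..<n} \<rightarrow>\<^sub>E {0..<int m}"
  using assms by (simp add: Zmn_def carrier_integer_mod_group)

lemma group_Zmn: "group (Zmn m n)"
  by (simp add: Zmn_def)

lemma pow_Zmn:
  "d [^]\<^bsub>Zmn m n\<^esub> (i::nat) = (\<lambda>j\<in>{..<n}. (int i * d j) mod int m)"
proof (induction i)
  case 0
  show ?case by (simp add: Zmn_def)
next
  case (Suc i)
  then show ?case
    by (auto simp: Zmn_def fun_eq_iff mod_simps algebra_simps)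
qed

lemma ap_term_Zmn:
  "ap_term (Zmn m n) a d i = (\<lambda>j\<in>{..<n}. (a j + int i * d j) mod int m)"
  unfolding ap_term_def pow_Zmn
  by (auto simp: Zmn_def fun_eq_iff mod_simps)

end

theory Submission
  imports Defs "HOL-Library.Numeral_Type" "HOL-Library.Function_Algebras"
begin

text \<open>
  Write \<open>\<int>\<^sub>6\<^sup>n\<close> as \<open>\<int>\<^sub>2\<^sup>n \<times> \<int>\<^sub>3\<^sup>n\<close>. A progression of six distinct terms is the product of two distinct points of
  \<open>\<int>\<^sub>2\<^sup>n\<close> with a line of \<open>\<int>\<^sub>3\<^sup>n\<close>, so \<open>A\<close> avoids such progressions iff every line of \<open>\<int>\<^sub>3\<^sup>n\<close> lies in at most one of
  its \<open>2\<^sup>n\<close> slices. In particular all slices may be equal to one cap, which gives the middle inequality.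

  Upper bound: the slice rank method bounds caps in \<open>\<int>\<^sub>3\<^sup>m\<close> by \<open>3 \<cdot> 2.7552\<^sup>m\<close>, where dimension arguments can be
  replaced by counting vectors since the field is finite. A subset of \<open>\<int>\<^sub>3\<^sup>m\<close> larger than the maximal cap by \<open>k\<close>
  contains at least \<open>k\<close> lines (with a marked pair of points). Averaging this over all affine maps from
  \<open>\<int>\<^sub>3\<^sup>m\<close> to \<open>\<int>\<^sub>3\<^sup>n\<close>, applied to the preimages of all slices, and using that there are only \<open>9\<^sup>n\<close> pairs of points
  in \<open>\<int>\<^sub>3\<^sup>n\<close>, bounds the total size of the slices.

  Lower bound: following Edel, start from sets \<open>A\<^sub>0, A\<^sub>1, A\<^sub>2\<close> of sizes 12, 112, 112 in \<open>\<int>\<^sub>3\<^sup>6\<close> and take unions of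
  products \<open>A\<^bsub>w 1\<^esub> \<times> \<dots> \<times> A\<^bsub>w k\<^esub>\<close> over words \<open>w\<close> in which any three words are separated at some position. A
  first round uses words of length 8 with one zero, a second round words of length 9 with four zeros.
  The resulting cap in dimension 432 has size \<open>126 \<cdot> (8 \<cdot> 12 \<cdot> 112\<^sup>7)\<^sup>4 \<cdot> (112\<^sup>8)\<^sup>5\<close>, which exceeds \<open>2.217\<^sup>4\<^sup>3\<^sup>2\<close>; its powers
  give the bound in all dimensions.
\<close>

section \<open>The slice rank bound for caps\<close>

lemma three_cases:
  fixes x :: 3
  obtains "x = 0" | "x = 1" | "x = 2"
proof (cases x rule: bit1_cases)
  case (of_int z)
  then have "z = 0 \<or> z = 1 \<or> z = 2" by auto
  with of_int that show thesis by auto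
qed

lemma square_eq_one_3: "a \<noteq> 0 \<Longrightarrow> a * a = (1::3)"
  by (cases a rule: three_cases) simp_all

lemma triple_sum_3: "a + a + a = (0::3)"
  by (cases a rule: three_cases) simp_all

lemma sum_eq_0_3_iff:
  "a + b + c = (0::3) \<longleftrightarrow> (a = b \<and> b = c) \<or> (a \<noteq> b \<and> b \<noteq> c \<and> a \<noteq> c)"
  by (cases a rule: three_cases; cases b rule: three_cases; cases c rule: three_cases; simp)

lemma slice_rank_diagonal:
  fixes f :: "'b \<Rightarrow> 'a \<Rightarrow> 3"
  assumes finA: "finite A" and finM: "finite M"
    and delta: "\<And>x y z. x \<in> A \<Longrightarrow> y \<in> A \<Longrightarrow> z \<in> A \<Longrightarrow>
      (if x = y \<and> y = z then 1 else 0) =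
        (\<Sum>a\<in>M. f a x * F a y z) + (\<Sum>a\<in>M. f a y * G a x z) + (\<Sum>a\<in>M. f a z * H a x y)"
  shows "card A \<le> 3 * card M"
proof -
  \<comment> \<open>Functions in \<open>W\<close> annihilate the third family of slices when the
    tensor is contracted in its last argument.\<close>
  define W where "W = {h. (\<forall>z. z \<notin> A \<longrightarrow> h z = 0) \<and> (\<forall>a\<in>M. (\<Sum>z\<in>A. h z * f a z) = 0)}"
  define S where "S h = {z\<in>A. h z \<noteq> (0::3)}" for h
  have "(\<lambda>_. 0) \<in> W" by (simp add: W_def)
  moreover have "\<forall>h. h \<in> W \<longrightarrow> card (S h) < Suc (card A)"
    by (auto simp: S_def finA less_Suc_eq_le intro!: card_mono)
  \<comment> \<open>By maximality the support of \<open>h\<close> misses at most \<open>card M\<close> points; contracting the tensor with \<open>h\<close> in the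
    last argument leaves an invertible diagonal matrix on this support, of rank at most \<open>2 * card M\<close>.\<close>
  ultimately obtain h where h: "h \<in> W" and hmax: "\<And>g. g \<in> W \<Longrightarrow> card (S g) \<le> card (S h)"
    using ex_has_greatest_nat[of "\<lambda>h. h \<in> W" _ "\<lambda>h. card (S h)" "Suc (card A)"] by blast
  have finS: "finite (S h)" "S h \<subseteq> A" using finA by (auto simp: S_def)
  have cardPiE: "card (B \<rightarrow>\<^sub>E (UNIV::3 set)) = 3 ^ card B" if "finite B" for B :: "'c set"
    using that by (simp add: card_PiE)
  define \<Phi> where "\<Phi> B g = (\<lambda>a\<in>M. \<Sum>z\<in>B. g z * f a z)" for B and g :: "'a \<Rightarrow> 3"
  have "card (A - S h) \<le> card M"
  proof (rule ccontr)
    let ?B = "A - S h"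
    assume "\<not> card ?B \<le> card M"
    \<comment> \<open>Pigeonhole in place of a dimension count: two functions on the complement of
      the support have the same pairings with all \<open>f a\<close>. Their difference
      \<open>w\<close> is a nonzero element of \<open>W\<close> living off the support of
      \<open>h\<close>, so \<open>h + w\<close> has larger support.\<close>
    then have "card (M \<rightarrow>\<^sub>E (UNIV::3 set)) < card (?B \<rightarrow>\<^sub>E (UNIV::3 set))"
      using finA finM by (simp add: cardPiE)
    moreover have "\<Phi> ?B ` (?B \<rightarrow>\<^sub>E UNIV) \<subseteq> M \<rightarrow>\<^sub>E UNIV" by (auto simp: \<Phi>_def)
    ultimately have "\<not> inj_on (\<Phi> ?B) (?B \<rightarrow>\<^sub>E UNIV)"
      using card_inj_on_le[of "\<Phi> ?B" "?B \<rightarrow>\<^sub>E UNIV" "M \<rightarrow>\<^sub>E UNIV"] finM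
      by (meson finite_PiE finite leD)
    then obtain g g' where g: "g \<in> ?B \<rightarrow>\<^sub>E UNIV" "g' \<in> ?B \<rightarrow>\<^sub>E UNIV" "g \<noteq> g'" "\<Phi> ?B g = \<Phi> ?B g'"
      by (auto simp: inj_on_def)
    then obtain z0 where z0: "z0 \<in> ?B" "g z0 \<noteq> g' z0"
      by (meson PiE_ext)
    define w where "w z = (if z \<in> ?B then g z - g' z else 0)" for z
    have w0: "(\<Sum>z\<in>A. w z * f a z) = 0" if "a \<in> M" for a
    proof -
      have "(\<Sum>z\<in>A. w z * f a z) = (\<Sum>z\<in>?B. w z * f a z)"
        by (rule sum.mono_neutral_right) (auto simp: finA w_def)
      also have "\<dots> = (\<Sum>z\<in>?B. g z * f a z) - (\<Sum>z\<in>?B. g' z * f a z)"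
        by (simp add: w_def algebra_simps sum_subtractf)
      also have "\<dots> = 0" using fun_cong[OF g(4), of a] that by (simp add: \<Phi>_def)
      finally show ?thesis .
    qed
    have "(\<lambda>z. h z + w z) \<in> W"
      using h w0 by (auto simp: W_def w_def algebra_simps sum.distrib)
    then have le: "card (S (\<lambda>z. h z + w z)) \<le> card (S h)" by (rule hmax)
    have "insert z0 (S h) \<subseteq> S (\<lambda>z. h z + w z)"
      using z0 by (auto simp: S_def w_def)
    then have "card (insert z0 (S h)) \<le> card (S (\<lambda>z. h z + w z))"
      by (rule card_mono[rotated]) (auto simp: S_def finA)
    then show False using le z0 finS by (simp add: card_insert_if)
  qed
  moreover have "card (S h) \<le> 2 * card M"
  proof -
    \<comment> \<open>The contracted matrix acts on \<open>v\<close> only through these two lists of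
      \<open>card M\<close> coefficients.\<close>
    define \<Psi> where "\<Psi> v = ((\<lambda>a\<in>M. \<Sum>x\<in>S h. v x * f a x),
        (\<lambda>a\<in>M. \<Sum>x\<in>S h. v x * (\<Sum>z\<in>A. h z * G a x z)))" for v
    \<comment> \<open>The tensor is contracted with \<open>v\<close> in the first and
      \<open>h\<close> in the third argument, once through its diagonal form and once through the
      slices. As \<open>h y\<close> is invertible on the support, \<open>\<Psi> v\<close> determines
      \<open>v\<close>.\<close>
    have key: "v y * h y = (\<Sum>a\<in>M. fst (\<Psi> v) a * (\<Sum>z\<in>A. h z * F a y z)) + (\<Sum>a\<in>M. f a y * snd (\<Psi> v) a)"
      if y: "y \<in> S h" for v y
    proof -
      have yA: "y \<in> A" using y finS by auto
      have "v y * h y = (\<Sum>x\<in>S h. v x * (\<Sum>z\<in>A. h z * (if x = y \<and> y = z then 1 else 0)))"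
      proof -
        have "(\<Sum>z\<in>A. h z * (if x = y \<and> y = z then 1 else 0)) = (if x = y then h y else 0)" for x
          using yA finA by (simp add: if_distrib[of "\<lambda>t. _ * t"] sum.delta' cong: if_cong)
        then show ?thesis using y finS by (simp add: if_distrib[of "\<lambda>t. _ * t"] cong: if_cong)
      qed
      also have "\<dots> = (\<Sum>x\<in>S h. v x * (\<Sum>z\<in>A. h z * ((\<Sum>a\<in>M. f a x * F a y z) + (\<Sum>a\<in>M. f a y * G a x z) + (\<Sum>a\<in>M. f a z * H a x y))))"
        using finS yA by (intro sum.cong refl arg_cong2[of _ _ _ _ "(*)"] delta) auto
      also have "\<dots> = (\<Sum>x\<in>S h. v x * (\<Sum>z\<in>A. h z * (\<Sum>a\<in>M. f a x * F a y z)))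
          + (\<Sum>x\<in>S h. v x * (\<Sum>z\<in>A. h z * (\<Sum>a\<in>M. f a y * G a x z)))
          + (\<Sum>x\<in>S h. v x * (\<Sum>z\<in>A. h z * (\<Sum>a\<in>M. f a z * H a x y)))"
        by (simp add: algebra_simps sum.distrib)
      also have "(\<Sum>x\<in>S h. v x * (\<Sum>z\<in>A. h z * (\<Sum>a\<in>M. f a z * H a x y))) = 0"
      proof (intro sum.neutral ballI)
        fix x
        have "(\<Sum>z\<in>A. h z * (\<Sum>a\<in>M. f a z * H a x y)) = (\<Sum>a\<in>M. (\<Sum>z\<in>A. h z * f a z) * H a x y)"
          by (simp add: sum_distrib_left sum_distrib_right mult.assoc) (rule sum.swap)
        also have "\<dots> = 0" using h by (simp add: W_def)
        finally show "v x * (\<Sum>z\<in>A. h z * (\<Sum>a\<in>M. f a z * H a x y)) = 0" by simp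
      qed
      also have "(\<Sum>x\<in>S h. v x * (\<Sum>z\<in>A. h z * (\<Sum>a\<in>M. f a x * F a y z)))
          = (\<Sum>a\<in>M. fst (\<Psi> v) a * (\<Sum>z\<in>A. h z * F a y z))"
      proof -
        have "(\<Sum>z\<in>A. h z * (\<Sum>a\<in>M. f a x * F a y z)) = (\<Sum>a\<in>M. f a x * (\<Sum>z\<in>A. h z * F a y z))" for x
          by (simp add: sum_distrib_left mult.left_commute) (rule sum.swap)
        then have "(\<Sum>x\<in>S h. v x * (\<Sum>z\<in>A. h z * (\<Sum>a\<in>M. f a x * F a y z)))
          = (\<Sum>x\<in>S h. \<Sum>a\<in>M. v x * f a x * (\<Sum>z\<in>A. h z * F a y z))"
          by (simp add: sum_distrib_left[of "v _"] mult.assoc)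
        also have "\<dots> = (\<Sum>a\<in>M. \<Sum>x\<in>S h. v x * f a x * (\<Sum>z\<in>A. h z * F a y z))" by (rule sum.swap)
        finally show ?thesis by (simp add: \<Psi>_def sum_distrib_right[of _ "S h"])
      qed
      also have "(\<Sum>x\<in>S h. v x * (\<Sum>z\<in>A. h z * (\<Sum>a\<in>M. f a y * G a x z)))
          = (\<Sum>a\<in>M. f a y * snd (\<Psi> v) a)"
      proof -
        have "(\<Sum>z\<in>A. h z * (\<Sum>a\<in>M. f a y * G a x z)) = (\<Sum>a\<in>M. f a y * (\<Sum>z\<in>A. h z * G a x z))" for x
          by (simp add: sum_distrib_left mult.left_commute) (rule sum.swap)
        moreover have "v x * (\<Sum>a\<in>M. f a y * g a) = (\<Sum>a\<in>M. f a y * (v x * g a))" for x and g :: "'b \<Rightarrow> 3"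
          by (simp add: sum_distrib_left mult.left_commute)
        ultimately have "(\<Sum>x\<in>S h. v x * (\<Sum>z\<in>A. h z * (\<Sum>a\<in>M. f a y * G a x z)))
          = (\<Sum>x\<in>S h. \<Sum>a\<in>M. f a y * (v x * (\<Sum>z\<in>A. h z * G a x z)))"
          by simp
        also have "\<dots> = (\<Sum>a\<in>M. \<Sum>x\<in>S h. f a y * (v x * (\<Sum>z\<in>A. h z * G a x z)))" by (rule sum.swap)
        finally show ?thesis by (simp add: \<Psi>_def sum_distrib_left[of "f _ _"])
      qed
      finally show ?thesis by simp
    qed
    have "inj_on \<Psi> (S h \<rightarrow>\<^sub>E UNIV)"
    proof (rule inj_onI)
      fix v v' assume v: "v \<in> S h \<rightarrow>\<^sub>E UNIV" "v' \<in> S h \<rightarrow>\<^sub>E UNIV" "\<Psi> v = \<Psi> v'"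
      show "v = v'"
      proof (rule PiE_ext[OF v(1,2)])
        fix y assume y: "y \<in> S h"
        then have "v y * h y = v' y * h y" using key v(3) by simp
        then have "v y * (h y * h y) = v' y * (h y * h y)" by (simp add: mult.assoc[symmetric])
        then show "v y = v' y" using y square_eq_one_3[of "h y"] by (simp add: S_def)
      qed
    qed
    moreover have "\<Psi> ` (S h \<rightarrow>\<^sub>E UNIV) \<subseteq> (M \<rightarrow>\<^sub>E UNIV) \<times> (M \<rightarrow>\<^sub>E UNIV)" by (auto simp: \<Psi>_def)
    ultimately have "card (S h \<rightarrow>\<^sub>E (UNIV::3 set)) \<le> card ((M \<rightarrow>\<^sub>E (UNIV::3 set)) \<times> (M \<rightarrow>\<^sub>E (UNIV::3 set)))"
      using finM by (intro card_inj_on_le) (auto intro!: finite_cartesian_product finite_PiE)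
    then have "3 ^ card (S h) \<le> (3::nat) ^ (card M + card M)"
      using finS finM by (simp add: cardPiE card_cartesian_product power_add)
    then show ?thesis by simp
  qed
  moreover have "card A = card (S h) + card (A - S h)"
    using finS finA by (simp add: card_Diff_subset card_mono)
  ultimately show ?thesis by simp
qed

section \<open>The polynomial method for caps modulo 3\<close>

text \<open>Modulo 3 three distinct points form a progression exactly if they sum to zero; the
  condition is symmetric in the points, unlike the one with a first term and a difference.\<close>

definition cap_on :: "nat \<Rightarrow> (nat \<Rightarrow> 3) set \<Rightarrow> bool" where
  "cap_on n A \<longleftrightarrow> (\<forall>x\<in>A. \<forall>y\<in>A. \<forall>z\<in>A. (\<forall>i<n. x i + y i + z i = 0) \<longrightarrow> x = y \<and> y = z)"

text \<open>Exponents of monomials in \<open>n\<close> variables of total degree at most 2n/3, with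
  each variable of degree at most 2.\<close>

definition low_degree :: "nat \<Rightarrow> (nat \<Rightarrow> nat) set" where
  "low_degree n = {a \<in> {..<n} \<rightarrow>\<^sub>E {0..2}. 3 * (\<Sum>i<n. a i) \<le> 2 * n}"

lemma finite_low_degree: "finite (low_degree n)"
  unfolding low_degree_def by (rule finite_subset[OF _ finite_PiE[of "{..<n}" "\<lambda>_. {0..2}"]]) auto

text \<open>Exponential weights: every low degree exponent vector contributes at least
  \<open>s ^ (2 * n)\<close> to the generating function \<open>(1 + s ^ 3 + s ^ 6) ^ n\<close>.
  Taking the weight as a cube keeps the exponent 2n/3 integral.\<close>

lemma card_low_degree: "real (card (low_degree n)) \<le> 2.7552 ^ n"
proof -
  \<comment> \<open>\<open>t = s\<^sup>3\<close> is close to the minimum of \<open>(1 + t + t\<^sup>2) / t powr (2/3)\<close>.\<close>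
  define s :: real where "s = 0.84"
  have s: "0 < s" "s \<le> 1" by (simp_all add: s_def)
  have "real (card (low_degree n)) * (s ^ 2) ^ n = (\<Sum>a\<in>low_degree n. s ^ (2 * n))"
    by (simp add: power_mult)
  also have "\<dots> \<le> (\<Sum>a\<in>low_degree n. \<Prod>i<n. (s ^ 3) ^ a i)"
  proof (rule sum_mono)
    fix a assume "a \<in> low_degree n"
    then have "s ^ (2 * n) \<le> s ^ (3 * (\<Sum>i<n. a i))"
      using s by (intro power_decreasing) (auto simp: low_degree_def)
    also have "\<dots> = (\<Prod>i<n. (s ^ 3) ^ a i)"
      by (simp add: power_sum power_mult)
    finally show "s ^ (2 * n) \<le> (\<Prod>i<n. (s ^ 3) ^ a i)" .
  qed
  also have "\<dots> \<le> (\<Sum>a\<in>{..<n} \<rightarrow>\<^sub>E {0..2}. \<Prod>i<n. (s ^ 3) ^ a i)"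
  proof (rule sum_mono2)
    show "finite ({..<n} \<rightarrow>\<^sub>E {0..2::nat})" by (simp add: finite_PiE)
    show "low_degree n \<subseteq> {..<n} \<rightarrow>\<^sub>E {0..2}" by (auto simp: low_degree_def)
    show "0 \<le> (\<Prod>i<n. (s ^ 3) ^ a i)" for a
      using s by (intro prod_nonneg) simp
  qed
  also have "\<dots> = (\<Prod>i<n. \<Sum>j\<in>{0..2}. (s ^ 3) ^ j)"
    by (subst prod_sum_PiE) auto
  also have "\<dots> = (1 + s ^ 3 + s ^ 6) ^ n"
  proof -
    have "{0..2::nat} = {0, 1, 2}" by auto
    then show ?thesis by (simp add: add.assoc flip: power_mult)
  qed
  also have "\<dots> \<le> (2.7552 * s ^ 2) ^ n"
    by (rule power_mono) (simp_all add: s_def field_simps)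
  finally have "real (card (low_degree n)) * (s\<^sup>2) ^ n \<le> 2.7552 ^ n * (s\<^sup>2) ^ n"
    by (simp only: power_mult_distrib)
  then show ?thesis by (rule mult_right_le_imp_le) (use s in simp)
qed

text \<open>The monomials of 1 - (x + y + z)^2. Modulo 3 the squares have coefficient -1 = 2 and the
  mixed products -2 = 1.\<close>

definition exponents :: "(nat \<times> nat \<times> nat) set" where
  "exponents = {(0,0,0), (2,0,0), (0,2,0), (0,0,2), (1,1,0), (1,0,1), (0,1,1)}"

definition exponent_coeff :: "nat \<times> nat \<times> nat \<Rightarrow> 3" where
  "exponent_coeff e = (if e \<in> {(2,0,0), (0,2,0), (0,0,2)} then 2 else 1)"

lemma one_minus_square_expand:
  "1 - (x + y + z)\<^sup>2 = (\<Sum>e\<in>exponents. exponent_coeff e * (x ^ fst e * y ^ fst (snd e) * z ^ snd (snd e)))"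
  for x y z :: 3
  by (cases x rule: three_cases; cases y rule: three_cases; cases z rule: three_cases;
      simp add: exponents_def exponent_coeff_def)

definition monomial :: "nat \<Rightarrow> (nat \<Rightarrow> nat) \<Rightarrow> (nat \<Rightarrow> 3) \<Rightarrow> 3" where
  "monomial n a x = (\<Prod>i<n. x i ^ a i)"

text \<open>Collects the terms sharing a factor \<open>p a\<close>, which turns a sum over many
  monomials into one with a single slice for each \<open>a\<close>.\<close>

lemma sum_group_mult:
  fixes p :: "'b \<Rightarrow> 'c::comm_semiring_1"
  assumes "finite G" "finite M" "\<And>g. g \<in> G \<Longrightarrow> \<phi> g \<in> M"
  shows "(\<Sum>g\<in>G. p (\<phi> g) * q g) = (\<Sum>a\<in>M. p a * (\<Sum>g\<in>{g\<in>G. \<phi> g = a}. q g))"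
proof -
  have "(\<Sum>g\<in>G. p (\<phi> g) * q g) = (\<Sum>a\<in>M. \<Sum>g\<in>{g\<in>G. \<phi> g = a}. p (\<phi> g) * q g)"
    using assms by (intro sum.group[symmetric]) auto
  also have "\<dots> = (\<Sum>a\<in>M. p a * (\<Sum>g\<in>{g\<in>G. \<phi> g = a}. q g))"
    by (simp add: sum_distrib_left)
  finally show ?thesis .
qed

text \<open>The product of all 1 - (x_i + y_i + z_i)^2 is the indicator of x + y + z = 0, which on a
  cap is the diagonal tensor. Each monomial of this product has degree at most 2n, so its part in x,
  in y or in z has degree at most 2n/3.\<close>

theorem card_cap_on:
  assumes A: "A \<subseteq> {..<n} \<rightarrow>\<^sub>E UNIV" and cap: "cap_on n A"
  shows "card A \<le> 3 * card (low_degree n)"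
proof -
  define Gs where "Gs = {..<n} \<rightarrow>\<^sub>E exponents"
  define \<alpha> \<beta> \<gamma> where "\<alpha> g = (\<lambda>i\<in>{..<n}. fst (g i))"
    and "\<beta> g = (\<lambda>i\<in>{..<n}. fst (snd (g i)))" and "\<gamma> g = (\<lambda>i\<in>{..<n}. snd (snd (g i)))"
    for g :: "nat \<Rightarrow> nat \<times> nat \<times> nat"
  define \<kappa> where "\<kappa> g = (\<Prod>i<n. exponent_coeff (g i))" for g
  \<comment> \<open>The monomials are partitioned by the first of the three arguments in which they
    have low degree; that argument is split off as the slice variable.\<close>
  define G1 where "G1 = {g\<in>Gs. \<alpha> g \<in> low_degree n}"
  define G2 where "G2 = {g\<in>Gs - G1. \<beta> g \<in> low_degree n}"
  define G3 where "G3 = Gs - G1 - G2"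
  have finGs: "finite Gs" by (simp add: Gs_def exponents_def finite_PiE)
  then have fin: "finite G1" "finite G2" "finite G3" by (auto simp: G1_def G2_def G3_def)
  have G3: "\<gamma> g \<in> low_degree n" if "g \<in> G3" for g
  proof -
    have g: "g \<in> Gs" "\<alpha> g \<notin> low_degree n" "\<beta> g \<notin> low_degree n"
      using that by (auto simp: G1_def G2_def G3_def)
    have gi: "g i \<in> exponents" if "i < n" for i using g(1) that by (auto simp: Gs_def)
    have PiE: "\<alpha> g \<in> {..<n} \<rightarrow>\<^sub>E {0..2}" "\<beta> g \<in> {..<n} \<rightarrow>\<^sub>E {0..2}" "\<gamma> g \<in> {..<n} \<rightarrow>\<^sub>E {0..2}"
      using gi by (auto simp: \<alpha>_def \<beta>_def \<gamma>_def exponents_def) force+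
    have "(\<Sum>i<n. \<alpha> g i + \<beta> g i + \<gamma> g i) \<le> (\<Sum>i<n. 2)"
      using gi by (intro sum_mono) (force simp: \<alpha>_def \<beta>_def \<gamma>_def exponents_def)
    then show ?thesis using g(2,3) PiE by (simp add: low_degree_def sum.distrib)
  qed
  have expand: "(\<Prod>i<n. 1 - (x i + y i + z i)\<^sup>2) =
      (\<Sum>g\<in>Gs. \<kappa> g * (monomial n (\<alpha> g) x * monomial n (\<beta> g) y * monomial n (\<gamma> g) z))" for x y z
    unfolding one_minus_square_expand Gs_def
    by (subst prod_sum_PiE)
      (auto simp: exponents_def prod.distrib \<kappa>_def monomial_def \<alpha>_def \<beta>_def \<gamma>_def intro!: sum.cong)
  have split: "(\<Sum>g\<in>Gs. t g) = (\<Sum>g\<in>G1. t g) + (\<Sum>g\<in>G2. t g) + (\<Sum>g\<in>G3. t g)" for t :: "_ \<Rightarrow> 3"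
  proof -
    have "Gs = G1 \<union> (G2 \<union> G3)" by (auto simp: G1_def G2_def G3_def)
    moreover have "G1 \<inter> (G2 \<union> G3) = {}" "G2 \<inter> G3 = {}" by (auto simp: G1_def G2_def G3_def)
    ultimately show ?thesis using fin by (simp add: sum.union_disjoint add.assoc)
  qed
  show ?thesis
  proof (rule slice_rank_diagonal)
    show "finite A" by (rule finite_subset[OF A]) (simp add: finite_PiE)
    show "finite (low_degree n)" by (rule finite_low_degree)
    fix x y z assume xyz: "x \<in> A" "y \<in> A" "z \<in> A"
    have "(if x = y \<and> y = z then 1 else 0) = (\<Prod>i<n. 1 - (x i + y i + z i)\<^sup>2)"
    proof (cases "\<forall>i<n. x i + y i + z i = 0")
      case True
      then show ?thesis using cap xyz by (auto simp: cap_on_def)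
    next
      case False
      then obtain i where i: "i < n" "x i + y i + z i \<noteq> 0" by blast
      then have "1 - (x i + y i + z i)\<^sup>2 = 0"
        using square_eq_one_3[OF i(2)] by (simp only: power2_eq_square diff_self)
      with i(1) have "\<exists>i\<in>{..<n}. 1 - (x i + y i + z i)\<^sup>2 = 0" by blast
      then have "(\<Prod>i<n. 1 - (x i + y i + z i)\<^sup>2) = 0" by (intro prod_zero) auto
      moreover have "\<not> (x = y \<and> y = z)" using i(2) triple_sum_3 by metis
      ultimately show ?thesis by simp
    qed
    also have "\<dots> = (\<Sum>g\<in>G1. monomial n (\<alpha> g) x * (\<kappa> g * monomial n (\<beta> g) y * monomial n (\<gamma> g) z))
        + (\<Sum>g\<in>G2. monomial n (\<beta> g) y * (\<kappa> g * monomial n (\<alpha> g) x * monomial n (\<gamma> g) z))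
        + (\<Sum>g\<in>G3. monomial n (\<gamma> g) z * (\<kappa> g * monomial n (\<alpha> g) x * monomial n (\<beta> g) y))"
      unfolding expand split by (simp only: mult_ac)
    also have "\<dots> = (\<Sum>a\<in>low_degree n. monomial n a x * (\<Sum>g\<in>{g\<in>G1. \<alpha> g = a}. \<kappa> g * monomial n (\<beta> g) y * monomial n (\<gamma> g) z))
        + (\<Sum>a\<in>low_degree n. monomial n a y * (\<Sum>g\<in>{g\<in>G2. \<beta> g = a}. \<kappa> g * monomial n (\<alpha> g) x * monomial n (\<gamma> g) z))
        + (\<Sum>a\<in>low_degree n. monomial n a z * (\<Sum>g\<in>{g\<in>G3. \<gamma> g = a}. \<kappa> g * monomial n (\<alpha> g) x * monomial n (\<beta> g) y))"
      using fin G3 finite_low_degree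
      by (intro arg_cong2[of _ _ _ _ "(+)"] sum_group_mult) (auto simp: G1_def G2_def)
    finally show "(if x = y \<and> y = z then 1 else 0) = \<dots>" .
  qed
qed

section \<open>Families in which every line occurs at most once\<close>

definition vecs :: "nat \<Rightarrow> (nat \<Rightarrow> 3) set" where
  "vecs n = {..<n} \<rightarrow>\<^sub>E UNIV"

text \<open>The remaining point of the line through distinct \<open>x\<close> and \<open>y\<close>;
  for \<open>x = y\<close> it is \<open>x\<close> itself when \<open>x\<close> is in
  \<open>vecs n\<close>.\<close>

definition third :: "nat \<Rightarrow> (nat \<Rightarrow> 3) \<Rightarrow> (nat \<Rightarrow> 3) \<Rightarrow> nat \<Rightarrow> 3" where
  "third n x y = (\<lambda>i\<in>{..<n}. - (x i + y i))"

lemma finite_vecs [simp]: "finite (vecs n)" and card_vecs: "card (vecs n) = 3 ^ n"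
  by (simp_all add: vecs_def finite_PiE card_PiE)

lemma third_in_vecs [simp]: "third n x y \<in> vecs n"
  by (simp add: vecs_def third_def)

lemma vecs_eqI:
  assumes "x \<in> vecs n" "y \<in> vecs n" "\<And>i. i < n \<Longrightarrow> x i = y i"
  shows "x = y"
  using assms unfolding vecs_def by (intro PiE_ext) auto

lemma eq_third_iff:
  assumes "z \<in> vecs n"
  shows "z = third n x y \<longleftrightarrow> (\<forall>i<n. x i + y i + z i = 0)"
proof
  assume "\<forall>i<n. x i + y i + z i = 0"
  then have "z i = third n x y i" if "i < n" for i
    using that by (simp add: third_def eq_neg_iff_add_eq_0 add.commute del: minus_add_distrib)
  with assms show "z = third n x y" by (intro vecs_eqI) auto
qed (simp add: third_def)

lemma third_commute: "third n x y = third n y x"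
  by (simp add: third_def add.commute)

text \<open>In each coordinate the three entries all agree or all differ, so equality of two of the
  vectors forces the third to be equal as well.\<close>

lemma sum_zero_distinct:
  assumes "x \<in> vecs n" "y \<in> vecs n" "z \<in> vecs n" "\<forall>i<n. x i + y i + z i = 0" "\<not> (x = y \<and> y = z)"
  shows "x \<noteq> y" "y \<noteq> z" "x \<noteq> z"
proof -
  have eq: "(x i = y i \<and> y i = z i) \<or> (x i \<noteq> y i \<and> y i \<noteq> z i \<and> x i \<noteq> z i)" if "i < n" for i
    using assms(4) that by (simp flip: sum_eq_0_3_iff)
  show "x \<noteq> y" using vecs_eqI[OF assms(2,3)] eq assms(5) by auto
  show "y \<noteq> z" using vecs_eqI[OF assms(1,2)] eq assms(5) by auto
  show "x \<noteq> z" using vecs_eqI[OF assms(1,2)] eq assms(5) by auto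
qed

text \<open>A cap \<open>C\<close> of maximum size inside \<open>S\<close> cannot be enlarged, so
  each \<open>s\<close> outside it completes a line with two points of \<open>C\<close>. The marked
  pairs \<open>(s, c s)\<close> differ in their first entries.\<close>

lemma card_le_cap_plus_lines:
  assumes S: "S \<subseteq> vecs m" and K: "\<And>C. C \<subseteq> vecs m \<Longrightarrow> cap_on m C \<Longrightarrow> card C \<le> K"
  shows "card S \<le> K + card {(x, y). x \<in> S \<and> y \<in> S \<and> x \<noteq> y \<and> third m x y \<in> S}" (is "_ \<le> K + card ?L")
proof -
  have finS: "finite S" using S by (rule finite_subset) simp
  define P where "P C \<longleftrightarrow> C \<subseteq> S \<and> cap_on m C" for C
  have "P {}" by (simp add: P_def cap_on_def)
  moreover have "\<forall>C. P C \<longrightarrow> card C < Suc (card S)"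
    using finS by (auto simp: P_def less_Suc_eq_le intro: card_mono)
  ultimately obtain C where "P C" and Cmax: "\<And>C'. P C' \<Longrightarrow> card C' \<le> card C"
    using ex_has_greatest_nat[of P "{}" card "Suc (card S)"] by blast
  then have C: "C \<subseteq> S" "cap_on m C" by (auto simp: P_def)
  have finC: "finite C" using C(1) finS finite_subset by blast
  have "\<exists>c\<in>C. third m s c \<in> C" if s: "s \<in> S - C" for s
  proof -
    have "\<not> cap_on m (insert s C)"
    proof
      assume "cap_on m (insert s C)"
      then have "card (insert s C) \<le> card C" using s C by (intro Cmax) (auto simp: P_def)
      with s finC show False by simp
    qed
    then obtain x y z where xyz: "x \<in> insert s C" "y \<in> insert s C" "z \<in> insert s C"
        "\<forall>i<m. x i + y i + z i = 0" "\<not> (x = y \<and> y = z)"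
      unfolding cap_on_def by blast
    have V: "x \<in> vecs m" "y \<in> vecs m" "z \<in> vecs m" using xyz C S s by auto
    have "x \<noteq> y" "y \<noteq> z" "x \<noteq> z"
      using sum_zero_distinct[OF V xyz(4,5)] by simp_all
    moreover have "\<not> (x \<in> C \<and> y \<in> C \<and> z \<in> C)" using C(2) xyz(4,5) by (auto simp: cap_on_def)
    moreover have "x = third m y z" "y = third m x z" "z = third m x y"
      using xyz(4) V by (simp_all add: eq_third_iff ac_simps)
    ultimately show ?thesis using xyz(1-3) third_commute by (metis insertE)
  qed
  then obtain c where c: "\<And>s. s \<in> S - C \<Longrightarrow> c s \<in> C \<and> third m s (c s) \<in> C" by metis
  have "card (S - C) \<le> card ?L"
  proof (rule card_inj_on_le)
    show "inj_on (\<lambda>s. (s, c s)) (S - C)" by (rule inj_onI) simp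
    show "(\<lambda>s. (s, c s)) ` (S - C) \<subseteq> ?L"
    proof (rule image_subsetI)
      fix s assume "s \<in> S - C"
      with c[of s] C(1) show "(s, c s) \<in> ?L" by auto
    qed
    show "finite ?L" by (rule finite_subset[of _ "S \<times> S"]) (auto simp: finS)
  qed
  moreover have "card C \<le> K" using K C S by auto
  moreover have "card S = card C + card (S - C)"
    using C finS finC by (simp add: card_Diff_subset card_mono)
  ultimately show ?thesis by simp
qed

section \<open>Averaging over affine maps\<close>

text \<open>A map is encoded by its translation and matrix, so that counting maps is counting in a
  product set. Singular matrices are included, which keeps images of points uniformly
  distributed.\<close>

definition affine_maps :: "nat \<Rightarrow> nat \<Rightarrow> ((nat \<Rightarrow> 3) \<times> (nat \<times> nat \<Rightarrow> 3)) set" where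
  "affine_maps n m = vecs n \<times> ({..<n} \<times> {..<m} \<rightarrow>\<^sub>E UNIV)"

fun affine_apply :: "nat \<Rightarrow> nat \<Rightarrow> (nat \<Rightarrow> 3) \<times> (nat \<times> nat \<Rightarrow> 3) \<Rightarrow> (nat \<Rightarrow> 3) \<Rightarrow> nat \<Rightarrow> 3" where
  "affine_apply n m (a, M) z = (\<lambda>j\<in>{..<n}. a j + (\<Sum>l<m. M (j, l) * z l))"

lemma affine_apply_in_vecs [simp]: "affine_apply n m f z \<in> vecs n"
  by (cases f) (simp add: vecs_def)

lemma finite_affine_maps [simp]: "finite (affine_maps n m)"
  by (auto simp: affine_maps_def intro!: finite_cartesian_product finite_PiE)

lemma card_matrices: "card ({..<n} \<times> {..<m} \<rightarrow>\<^sub>E (UNIV::3 set)) = 3 ^ (n * m)"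
  by (simp add: card_PiE card_cartesian_product)

lemma card_affine_maps: "card (affine_maps n m) = 3 ^ n * 3 ^ (n * m)"
  by (simp add: affine_maps_def card_cartesian_product card_vecs card_matrices)

lemma affine_apply_third:
  "affine_apply n m f (third m z w) = third n (affine_apply n m f z) (affine_apply n m f w)"
proof (cases f)
  case (Pair a M)
  have "a j + (\<Sum>l<m. M (j, l) * third m z w l) =
      - (a j + (\<Sum>l<m. M (j, l) * z l) + (a j + (\<Sum>l<m. M (j, l) * w l)))" for j
  proof -
    have "(\<Sum>l<m. M (j, l) * third m z w l) = (\<Sum>l<m. - (M (j, l) * z l) - M (j, l) * w l)"
      by (intro sum.cong) (auto simp: third_def algebra_simps)
    then have "(\<Sum>l<m. M (j, l) * third m z w l) = - (\<Sum>l<m. M (j, l) * z l) - (\<Sum>l<m. M (j, l) * w l)"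
      by (simp add: sum_negf sum_subtractf)
    moreover have "a j + (- p - q) = - (a j + p + (a j + q))" for p q :: 3
      by (cases "a j" rule: three_cases; cases p rule: three_cases; cases q rule: three_cases; simp)
    ultimately show ?thesis by simp
  qed
  then show ?thesis by (auto simp: Pair third_def)
qed

text \<open>For each matrix and each target point exactly one translation sends \<open>z\<close> to
  that point.\<close>

lemma card_affine_maps_into:
  assumes X: "X \<subseteq> vecs n"
  shows "card X * 3 ^ (n * m) \<le> card {f \<in> affine_maps n m. affine_apply n m f z \<in> X}"
proof -
  let ?M = "{..<n} \<times> {..<m} \<rightarrow>\<^sub>E (UNIV::3 set)"
  define h where "h = (\<lambda>(p, M). (\<lambda>j\<in>{..<n}. p j - (\<Sum>l<m. M (j, l) * z l), M :: nat \<times> nat \<Rightarrow> 3))"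
  have app: "affine_apply n m (h (p, M)) z = p" if "p \<in> vecs n" for p M
    using that by (auto simp: h_def fun_eq_iff vecs_def PiE_def extensional_def)
  have "card (X \<times> ?M) \<le> card {f \<in> affine_maps n m. affine_apply n m f z \<in> X}"
  proof (rule card_inj_on_le[where f = h])
    show "inj_on h (X \<times> ?M)"
    proof (rule inj_onI, clarify)
      fix p M p' M' assume pp: "p \<in> X" "p' \<in> X" and eq: "h (p, M) = h (p', M')"
      then have "M = M'" by (simp add: h_def)
      moreover have "p = p'" using app[of p M] app[of p' M'] eq pp X by auto
      ultimately show "p = p' \<and> M = M'" by simp
    qed
    show "h ` (X \<times> ?M) \<subseteq> {f \<in> affine_maps n m. affine_apply n m f z \<in> X}"
    proof (rule image_subsetI)
      fix t assume "t \<in> X \<times> ?M"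
      then obtain p M where t: "t = (p, M)" "p \<in> X" "M \<in> ?M" by blast
      then have "h t \<in> affine_maps n m"
        by (simp add: h_def affine_maps_def vecs_def)
      moreover have "affine_apply n m (h t) z \<in> X" using app t X by auto
      ultimately show "h t \<in> {f \<in> affine_maps n m. affine_apply n m f z \<in> X}" by simp
    qed
  qed simp
  then show ?thesis by (simp add: card_cartesian_product card_matrices)
qed

text \<open>In a coordinate \<open>k\<close> where \<open>z\<close> and \<open>w\<close> differ, a
  collision determines column \<open>k\<close> of the matrix from the other columns. Collapsing maps
  are therefore at most a 3^-n fraction of all maps.\<close>

lemma card_affine_maps_collide:
  assumes "z \<in> vecs m" "w \<in> vecs m" "z \<noteq> w"
  shows "card {f \<in> affine_maps n m. affine_apply n m f z = affine_apply n m f w} \<le> 3 ^ (n * m)"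
proof -
  obtain k where k: "k < m" "z k \<noteq> w k"
    using assms unfolding vecs_def by (metis PiE_ext lessThan_iff)
  let ?M = "{..<n} \<times> {..<m} \<rightarrow>\<^sub>E (UNIV::3 set)"
  let ?F = "{f \<in> affine_maps n m. affine_apply n m f z = affine_apply n m f w}"
  \<comment> \<open>The redundant column \<open>k\<close> makes room for the translation, so that
    both parts are stored in one matrix.\<close>
  define h where "h = (\<lambda>(a, M). \<lambda>p\<in>{..<n} \<times> {..<m}. if snd p = k then a (fst p) else M p :: 3)"
  have "card ?F \<le> card ?M"
  proof (rule card_inj_on_le[where f = h])
    show "finite ?M" by (simp add: finite_PiE)
    show "h ` ?F \<subseteq> ?M" unfolding h_def by (intro image_subsetI) (simp add: case_prod_beta)
    show "inj_on h ?F"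
    proof (rule inj_onI)
      fix f g assume f: "f \<in> ?F" and g: "g \<in> ?F" and eq: "h f = h g"
      obtain a M b N where fg: "f = (a, M)" "g = (b, N)" by (cases f, cases g)
      have MN: "M \<in> ?M" "N \<in> ?M" and ab: "a \<in> vecs n" "b \<in> vecs n"
        using f g by (simp_all add: fg affine_maps_def)
      have "a j = b j" if "j < n" for j
        using fun_cong[OF eq, of "(j, k)"] that k by (simp add: h_def fg)
      with ab have "a = b" by (rule vecs_eqI)
      have off: "M (j, l) = N (j, l)" if "j < n" "l < m" "l \<noteq> k" for j l
        using fun_cong[OF eq, of "(j, l)"] that by (simp add: h_def fg)
      have on: "M (j, k) = N (j, k)" if j: "j < n" for j
      proof -
        have zero: "P (j, k) * (z k - w k) = - (\<Sum>l\<in>{..<m} - {k}. P (j, l) * (z l - w l))"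
          if "affine_apply n m (c, P) z = affine_apply n m (c, P) w" for c P
        proof -
          have "(\<Sum>l<m. P (j, l) * z l) = (\<Sum>l<m. P (j, l) * w l)"
            using fun_cong[OF that, of j] j by simp
          then have "(\<Sum>l<m. P (j, l) * (z l - w l)) = 0"
            by (simp add: right_diff_distrib sum_subtractf)
          then show ?thesis
            using k by (simp add: sum.remove[of _ k] eq_neg_iff_add_eq_0)
        qed
        have "M (j, k) * (z k - w k) = N (j, k) * (z k - w k)"
          using zero[of a M] zero[of b N] f g off j by (simp add: fg)
        then have "M (j, k) * ((z k - w k) * (z k - w k)) = N (j, k) * ((z k - w k) * (z k - w k))"
          by (simp only: mult.assoc[symmetric])
        moreover have "(z k - w k) * (z k - w k) = 1" using k by (intro square_eq_one_3) simp
        ultimately show ?thesis by simp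
      qed
      have "M = N"
      proof (rule PiE_ext[OF MN])
        fix p assume "p \<in> {..<n} \<times> {..<m}"
        then show "M p = N p" using off on by (cases p) (metis SigmaD1 SigmaD2 lessThan_iff)
      qed
      with \<open>a = b\<close> show "f = g" by (simp add: fg)
    qed
  qed
  then show ?thesis by (simp add: card_matrices)
qed

lemma card_filter_eq_sum: "finite A \<Longrightarrow> card {x\<in>A. P x} = (\<Sum>x\<in>A. if P x then 1 else 0)"
  by (simp add: sum.If_cases Int_def)

lemma sum_card_swap:
  assumes "finite A" "finite B"
  shows "(\<Sum>x\<in>A. card {y\<in>B. P x y}) = (\<Sum>y\<in>B. card {x\<in>A. P x y})"
  unfolding card_filter_eq_sum[OF assms(1)] card_filter_eq_sum[OF assms(2)] by (rule sum.swap)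

text \<open>Pull the family back along a random affine map \<open>f\<close>: in each pullback all but \<open>K\<close> points are
  accounted for by pairs spanning a line, and a pair that \<open>f\<close> does not collapse is counted for at
  most one \<open>u\<close>.\<close>

theorem sum_card_line_disjoint_family:
  fixes B :: "'u \<Rightarrow> (nat \<Rightarrow> 3) set"
  assumes U: "finite U" and B: "\<And>u. u \<in> U \<Longrightarrow> B u \<subseteq> vecs n"
    and disj: "\<And>u v p q. \<lbrakk>u \<in> U; v \<in> U; p \<noteq> q; {p, q, third n p q} \<subseteq> B u; {p, q, third n p q} \<subseteq> B v\<rbrakk> \<Longrightarrow> u = v"
    and K: "\<And>C. C \<subseteq> vecs m \<Longrightarrow> cap_on m C \<Longrightarrow> card C \<le> K"
  shows "3 ^ m * (\<Sum>u\<in>U. card (B u)) \<le> card U * 3 ^ n * K + 9 ^ m * (3 ^ n + card U)"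
proof -
  define \<Phi> where "\<Phi> = affine_maps n m"
  define Z where "Z = {(z, w). z \<in> vecs m \<and> w \<in> vecs m \<and> z \<noteq> w}"
  let ?ap = "affine_apply n m"
  let ?N = "3 ^ (n * m) :: nat"
  have fin: "finite \<Phi>" by (simp add: \<Phi>_def)
  have finZ: "finite Z" by (rule finite_subset[of _ "vecs m \<times> vecs m"]) (auto simp: Z_def)
  have cardZ: "card Z \<le> 9 ^ m"
  proof -
    have "card Z \<le> card (vecs m \<times> vecs m)" by (rule card_mono) (auto simp: Z_def)
    then show ?thesis by (simp add: card_cartesian_product card_vecs flip: power_mult_distrib)
  qed
  define T where "T u f zw \<longleftrightarrow> (case zw of (z, w) \<Rightarrow> ?ap f z \<in> B u \<and> ?ap f w \<in> B u \<and> ?ap f (third m z w) \<in> B u)" for u f zw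
  \<comment> \<open>\<open>?N\<close> is the number of matrices, so
    \<open>card \<Phi> = 3 ^ n * ?N\<close>; the common factor \<open>?N\<close> is cancelled at the
    end.\<close>
  have "3 ^ m * (\<Sum>u\<in>U. card (B u)) * ?N = (\<Sum>u\<in>U. \<Sum>z\<in>vecs m. card (B u) * ?N)"
    by (simp add: card_vecs sum_distrib_left mult_ac)
  also have "\<dots> \<le> (\<Sum>u\<in>U. \<Sum>z\<in>vecs m. card {f \<in> \<Phi>. ?ap f z \<in> B u})"
    unfolding \<Phi>_def using B by (intro sum_mono card_affine_maps_into)
  also have "\<dots> = (\<Sum>u\<in>U. \<Sum>f\<in>\<Phi>. card {z \<in> vecs m. ?ap f z \<in> B u})"
    using fin by (intro sum.cong refl sum_card_swap) auto
  also have "\<dots> \<le> (\<Sum>u\<in>U. \<Sum>f\<in>\<Phi>. K + card {zw \<in> Z. T u f zw})"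
  proof (intro sum_mono)
    fix u f assume "u \<in> U"
    let ?S = "{z \<in> vecs m. ?ap f z \<in> B u}"
    have "card ?S \<le> K + card {(x, y). x \<in> ?S \<and> y \<in> ?S \<and> x \<noteq> y \<and> third m x y \<in> ?S}"
      by (rule card_le_cap_plus_lines) (use K in auto)
    also have "{(x, y). x \<in> ?S \<and> y \<in> ?S \<and> x \<noteq> y \<and> third m x y \<in> ?S} = {zw \<in> Z. T u f zw}"
      by (auto simp: T_def Z_def)
    finally show "card ?S \<le> K + card {zw \<in> Z. T u f zw}" .
  qed
  also have "\<dots> = card U * card \<Phi> * K + (\<Sum>u\<in>U. \<Sum>zw\<in>Z. card {f \<in> \<Phi>. T u f zw})"
    by (simp add: sum.distrib sum_card_swap[OF fin finZ] mult.assoc)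
  also have "(\<Sum>u\<in>U. \<Sum>zw\<in>Z. card {f \<in> \<Phi>. T u f zw}) = (\<Sum>zw\<in>Z. \<Sum>u\<in>U. card {f \<in> \<Phi>. T u f zw})"
    by (rule sum.swap)
  also have "\<dots> = (\<Sum>zw\<in>Z. \<Sum>f\<in>\<Phi>. card {u \<in> U. T u f zw})"
    using U fin by (intro sum.cong refl sum_card_swap)
  also have "\<dots> \<le> (\<Sum>zw\<in>Z. card \<Phi> + card U * ?N)"
  proof (rule sum_mono)
    fix p assume "p \<in> Z"
    then obtain z w where p: "p = (z, w)" and zw: "z \<in> vecs m" "w \<in> vecs m" "z \<noteq> w"
      by (auto simp: Z_def)
    let ?C = "{f \<in> \<Phi>. ?ap f z = ?ap f w}"
    \<comment> \<open>Maps that collapse the pair get the trivial bound \<open>card U\<close>, which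
      is affordable because they are rare.\<close>
    have "card {u \<in> U. T u f (z, w)} \<le> 1 + (if f \<in> ?C then card U else 0)" if "f \<in> \<Phi>" for f
    proof (cases "f \<in> ?C")
      case True
      then show ?thesis using U by (auto intro!: le_SucI card_mono)
    next
      case False
      then have ne: "?ap f z \<noteq> ?ap f w" using that by simp
      have "u = v" if "u \<in> U" "T u f (z, w)" "v \<in> U" "T v f (z, w)" for u v
        using that by (intro disj[OF _ _ ne]) (auto simp: T_def affine_apply_third)
      then have "card {u \<in> U. T u f (z, w)} \<le> 1"
        using U by (subst One_nat_def, subst card_le_Suc0_iff_eq) auto
      then show ?thesis by simp
    qed
    then have "(\<Sum>f\<in>\<Phi>. card {u \<in> U. T u f (z, w)}) \<le> (\<Sum>f\<in>\<Phi>. 1 + (if f \<in> ?C then card U else 0))"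
      by (rule sum_mono)
    also have "\<dots> = card \<Phi> + card ?C * card U"
      using fin by (simp only: sum.distrib) (simp add: sum.If_cases Int_def)
    also have "\<dots> \<le> card \<Phi> + card U * ?N"
      using card_affine_maps_collide[OF zw, of n] by (simp add: \<Phi>_def mult.commute)
    finally show "(\<Sum>f\<in>\<Phi>. card {u \<in> U. T u f p}) \<le> card \<Phi> + card U * ?N" by (simp add: p)
  qed
  also have "\<dots> \<le> 9 ^ m * (card \<Phi> + card U * ?N)"
    using cardZ by simp
  finally have "3 ^ m * (\<Sum>u\<in>U. card (B u)) * ?N \<le> (card U * 3 ^ n * K + 9 ^ m * (3 ^ n + card U)) * ?N"
    by (simp add: \<Phi>_def card_affine_maps algebra_simps)
  then show ?thesis by simp
qed

section \<open>Progressions modulo 3 and modulo 6\<close>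

text \<open>Caps live over the field type \<open>3\<close>, progressions over integer
  representatives; \<open>rep3\<close> and \<open>dec3\<close> translate between the two.\<close>

definition rep3 :: "3 \<Rightarrow> int" where
  "rep3 x = (if x = 0 then 0 else if x = 1 then 1 else 2)"

lemma of_int_rep3 [simp]: "of_int (rep3 x) = x"
  by (cases x rule: three_cases) (simp_all add: rep3_def)

lemma rep3_bounds: "0 \<le> rep3 x" "rep3 x < 3"
  by (simp_all add: rep3_def)

lemma of_int_3_eq_0_iff: "(of_int k :: 3) = 0 \<longleftrightarrow> k mod 3 = 0"
proof -
  have "(of_int k :: 3) = of_int (3 * (k div 3) + k mod 3)" by simp
  also have "\<dots> = 3 * of_int (k div 3) + of_int (k mod 3)"
    by (simp only: of_int_add of_int_mult of_int_numeral)
  also have "(3::3) = 0" by simp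
  finally have eq: "(of_int k :: 3) = of_int (k mod 3)" by simp
  have "k mod 3 = 0 \<or> k mod 3 = 1 \<or> k mod 3 = 2" by presburger
  then show ?thesis unfolding eq by auto
qed

lemma of_int_3_eq_iff: "(of_int k :: 3) = of_int l \<longleftrightarrow> k mod 3 = l mod 3"
  using of_int_3_eq_0_iff[of "k - l"] by (simp add: mod_eq_dvd_iff dvd_eq_mod_eq_0)

lemma rep3_of_int [simp]: "rep3 (of_int k) = k mod 3"
proof -
  have "rep3 (of_int k) mod 3 = k mod 3" by (simp flip: of_int_3_eq_iff)
  then show ?thesis using rep3_bounds[of "of_int k"] by simp
qed

text \<open>Serves as reduction modulo 3 both on \<open>Zmn 3 n\<close> and on
  \<open>Zmn 6 n\<close>.\<close>

definition dec3 :: "nat \<Rightarrow> (nat \<Rightarrow> int) \<Rightarrow> nat \<Rightarrow> 3" where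
  "dec3 n f = (\<lambda>j\<in>{..<n}. of_int (f j))"

lemma dec3_in_vecs [simp]: "dec3 n f \<in> vecs n"
  by (simp add: dec3_def vecs_def)

lemma dec3_ap_term:
  assumes "3 dvd m" "j < n"
  shows "dec3 n (ap_term (Zmn m n) a d i) j = of_int (a j) + of_nat i * of_int (d j)"
proof -
  have "((a j + int i * d j) mod int m) mod 3 = (a j + int i * d j) mod 3"
    using assms(1) by (intro mod_mod_cancel) (metis of_nat_dvd_iff of_nat_numeral)
  then have "(of_int ((a j + int i * d j) mod int m) :: 3) = of_int (a j + int i * d j)"
    by (simp only: of_int_3_eq_iff)
  then show ?thesis using assms(2) by (simp add: dec3_def ap_term_Zmn)
qed

lemma finite_carrier_Zmn: "m > 0 \<Longrightarrow> finite (carrier (Zmn m n))"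
  by (simp add: carrier_Zmn finite_PiE)

lemma
  assumes "finite (carrier G)" "k > 0"
  shows r_ap_ge: "A \<subseteq> carrier G \<Longrightarrow> \<not> contains_ap G k A \<Longrightarrow> card A \<le> r_ap k G"
    and r_ap_attained: "\<exists>A. A \<subseteq> carrier G \<and> \<not> contains_ap G k A \<and> card A = r_ap k G"
proof -
  let ?S = "{card A | A. A \<subseteq> carrier G \<and> \<not> contains_ap G k A}"
  have fin: "finite ?S"
    by (rule finite_subset[of _ "card ` Pow (carrier G)"]) (use assms(1) in auto)
  show "A \<subseteq> carrier G \<Longrightarrow> \<not> contains_ap G k A \<Longrightarrow> card A \<le> r_ap k G"
    unfolding r_ap_def using fin by (intro Max_ge) auto
  have "\<not> contains_ap G k {}" using assms(2) by (auto simp: contains_ap_def)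
  then have "?S \<noteq> {}" by blast
  from Max_in[OF fin this] show "\<exists>A. A \<subseteq> carrier G \<and> \<not> contains_ap G k A \<and> card A = r_ap k G"
    unfolding r_ap_def by auto
qed

text \<open>The first three terms reduce modulo 3 to points with sum zero, so the cap forces
  \<open>d\<close> to vanish modulo 3. Then \<open>2 * d\<close> vanishes modulo \<open>m\<close>,
  as \<open>m\<close> divides 6, and terms 0 and 2 coincide.\<close>

lemma cap_on_imp_no_ap:
  assumes m: "3 dvd m" "m dvd 6" and C: "cap_on n C" and A: "A \<subseteq> carrier (Zmn m n)" "dec3 n ` A \<subseteq> C"
    and k: "k \<ge> 3" and ap: "contains_ap (Zmn m n) k A"
  shows False
proof -
  let ?t = "ap_term (Zmn m n)"
  obtain a d where ad: "\<forall>i<k. ?t a d i \<in> A" "inj_on (?t a d) {..<k}"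
    using ap by (auto simp: contains_ap_def)
  let ?x = "\<lambda>i. dec3 n (?t a d i)"
  have mem: "?x i \<in> C" if "i < 3" for i using that ad(1) A(2) k by auto
  have "\<forall>j<n. ?x 0 j + ?x 1 j + ?x 2 j = 0"
  proof (intro allI impI)
    fix j assume "j < n"
    moreover have "p + 0 * q + (p + 1 * q) + (p + 2 * q) = 0" for p q :: 3
      by (cases p rule: three_cases; cases q rule: three_cases; simp)
    ultimately show "?x 0 j + ?x 1 j + ?x 2 j = 0"
      using m(1) by (simp only: dec3_ap_term) (simp only: of_nat_0 of_nat_1 of_nat_numeral)
  qed
  then have "?x 0 = ?x 1" using C mem[of 0] mem[of 1] mem[of 2] by (auto simp: cap_on_def)
  then have x01: "?x 0 j = ?x 1 j" for j by simp
  have d3: "3 dvd d j" if "j < n" for j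
  proof -
    have "of_int (a j) + of_nat 0 * (of_int (d j) :: 3) = of_int (a j) + of_nat 1 * of_int (d j)"
      using x01 by (simp only: dec3_ap_term[OF m(1) that, symmetric])
    then show ?thesis by (simp add: of_int_3_eq_0_iff dvd_eq_mod_eq_0)
  qed
  have "?t a d 2 = ?t a d 0"
  proof -
    have "(a j + 2 * d j) mod int m = a j mod int m" if "j < n" for j
    proof -
      have "int m dvd 2 * 3" using m(2) by (metis mult_2 numeral_Bit0 of_nat_dvd_iff of_nat_numeral numeral_Bit1 numeral_times_numeral semiring_norm(13))
      also have "2 * 3 dvd 2 * d j" using d3[OF that] by (intro mult_dvd_mono) auto
      finally show ?thesis by (simp add: mod_eq_dvd_iff)
    qed
    then show ?thesis by (auto simp: ap_term_Zmn)
  qed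
  then show False using ad(2) k by (auto dest!: inj_onD)
qed

lemma cap_on_le_r_ap_3:
  assumes C: "C \<subseteq> vecs n" "cap_on n C"
  shows "card C \<le> r_ap 3 (Zmn 3 n)"
proof -
  define enc where "enc x = (\<lambda>j\<in>{..<n}. rep3 (x j))" for x
  have dec: "dec3 n (enc x) = x" if "x \<in> vecs n" for x
    using that by (auto simp: dec3_def enc_def vecs_def PiE_def extensional_def)
  have sub: "enc ` C \<subseteq> carrier (Zmn 3 n)"
    by (intro image_subsetI) (simp add: enc_def carrier_Zmn rep3_bounds)
  have "dec3 n ` enc ` C \<subseteq> C" using dec C(1) by auto
  then have "\<not> contains_ap (Zmn 3 n) 3 (enc ` C)"
    by (intro notI) (rule cap_on_imp_no_ap[OF _ _ C(2) sub], simp_all)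
  with sub have "card (enc ` C) \<le> r_ap 3 (Zmn 3 n)"
    by (intro r_ap_ge finite_carrier_Zmn) auto
  moreover have "inj_on enc C" by (rule inj_on_inverseI[of _ "dec3 n"]) (use dec C in auto)
  ultimately show ?thesis by (simp add: card_image)
qed

text \<open>Three distinct points with sum zero form the progression with first term
  \<open>a\<close> and difference \<open>b - a\<close>, so an extremal set reduces to a cap of the
  same size.\<close>

lemma r_ap_3_cap:
  obtains C where "C \<subseteq> vecs n" "cap_on n C" "card C = r_ap 3 (Zmn 3 n)"
proof -
  obtain A where A: "A \<subseteq> carrier (Zmn 3 n)" "\<not> contains_ap (Zmn 3 n) 3 A" "card A = r_ap 3 (Zmn 3 n)"
    using r_ap_attained[OF finite_carrier_Zmn, of 3 3 n] by auto
  have car: "f \<in> carrier (Zmn 3 n) \<longleftrightarrow> f \<in> {..<n} \<rightarrow>\<^sub>E {0..<3}" for f by (simp add: carrier_Zmn)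
  have rng: "0 \<le> f j" "f j < 3" if "f \<in> A" "j < n" for f j
    using subsetD[OF A(1) that(1)] that(2) unfolding car by (auto dest!: PiE_mem[of _ _ _ j])
  have inj: "inj_on (dec3 n) (carrier (Zmn 3 n))"
  proof (rule inj_onI)
    fix f g assume f: "f \<in> carrier (Zmn 3 n)" and g: "g \<in> carrier (Zmn 3 n)" and eq: "dec3 n f = dec3 n g"
    show "f = g"
    proof (rule PiE_ext[OF f[unfolded car] g[unfolded car]])
      fix j assume j: "j \<in> {..<n}"
      then have "f j mod 3 = g j mod 3"
        using fun_cong[OF eq, of j] by (simp add: dec3_def of_int_3_eq_iff)
      moreover have "f j \<in> {0..<3}" "g j \<in> {0..<3}" using PiE_mem[OF f[unfolded car] j] PiE_mem[OF g[unfolded car] j] by simp_all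
      ultimately show "f j = g j" by simp
    qed
  qed
  show thesis
  proof
    show "dec3 n ` A \<subseteq> vecs n" by auto
    show "card (dec3 n ` A) = r_ap 3 (Zmn 3 n)"
      using A(3) card_image[OF inj_on_subset[OF inj A(1)]] by simp
    show "cap_on n (dec3 n ` A)"
      unfolding cap_on_def
    proof (intro ballI impI, rule ccontr)
      fix x y z assume "x \<in> dec3 n ` A" "y \<in> dec3 n ` A" "z \<in> dec3 n ` A"
        and sum0: "\<forall>i<n. x i + y i + z i = 0" and ne: "\<not> (x = y \<and> y = z)"
      then obtain a b c where abc: "a \<in> A" "b \<in> A" "c \<in> A"
        and xyz: "x = dec3 n a" "y = dec3 n b" "z = dec3 n c" by blast
      have "x \<noteq> y" "y \<noteq> z" "x \<noteq> z"
        using sum_zero_distinct[OF _ _ _ sum0 ne] by (auto simp: xyz)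
      then have dist: "a \<noteq> b" "b \<noteq> c" "a \<noteq> c" by (auto simp: xyz)
      define d where "d = (\<lambda>j\<in>{..<n}. (b j - a j) mod 3)"
      let ?t = "ap_term (Zmn 3 n) a d"
      have ext: "f \<in> extensional {..<n}" if "f \<in> A" for f
        using subsetD[OF A(1) that] by (simp add: car PiE_def)
      have t: "?t 0 = a" "?t 1 = b" "?t 2 = c"
      proof -
        have c: "(a j + 2 * ((b j - a j) mod 3)) mod 3 = c j" if j: "j < n" for j
        proof -
          have "of_int (a j + b j + c j) = (0::3)" using sum0 j by (simp add: xyz dec3_def)
          then have "(a j + b j + c j) mod 3 = 0" by (simp only: of_int_3_eq_0_iff)
          moreover have "a j \<in> {0, 1, 2}" "b j \<in> {0, 1, 2}" "c j \<in> {0, 1, 2}"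
            using rng[OF abc(1) j] rng[OF abc(2) j] rng[OF abc(3) j] by auto
          ultimately show ?thesis by auto
        qed
        have b: "(a j + (b j - a j) mod 3) mod 3 = b j" if j: "j < n" for j
          using rng[OF abc(2) j] by (simp add: mod_simps)
        have a: "a j mod 3 = a j" if j: "j < n" for j using rng[OF abc(1) j] by simp
        show "?t 0 = a" "?t 1 = b" "?t 2 = c"
          unfolding ap_term_Zmn using a b c ext[OF abc(1)] ext[OF abc(2)] ext[OF abc(3)]
          by (auto simp: d_def fun_eq_iff extensional_def)
      qed
      have "{..<3::nat} = {0, 1, 2}" by auto
      then have "(\<forall>i<3. ?t i \<in> A)" "inj_on ?t {..<3}"
        using t abc dist by (auto simp: numeral_eq_Suc less_Suc_eq)
      moreover have "a \<in> carrier (Zmn 3 n)" using abc A by auto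
      moreover have "d \<in> carrier (Zmn 3 n)" by (simp add: car d_def)
      ultimately have "contains_ap (Zmn 3 n) 3 A" unfolding contains_ap_def by blast
      with A(2) show False ..
    qed
  qed
qed

text \<open>The isomorphism of \<open>\<int>\<^sub>2\<^sup>n \<times> \<int>\<^sub>3\<^sup>n\<close> with \<open>\<int>\<^sub>6\<^sup>n\<close>: 3 and 4 are the idempotents of \<open>\<int>\<^sub>6\<close>.\<close>

definition crt :: "nat \<Rightarrow> (nat \<Rightarrow> int) \<Rightarrow> (nat \<Rightarrow> 3) \<Rightarrow> nat \<Rightarrow> int" where
  "crt n u x = (\<lambda>j\<in>{..<n}. (3 * u j + 4 * rep3 (x j)) mod 6)"

lemma crt_in_carrier: "crt n u x \<in> carrier (Zmn 6 n)"
  by (simp add: crt_def carrier_Zmn)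

lemma crt_mod_2:
  assumes "u \<in> {..<n} \<rightarrow>\<^sub>E {0, 1}" "j < n"
  shows "crt n u x j mod 2 = u j"
proof -
  have "u j = 0 \<or> u j = 1" using assms by (auto dest!: PiE_mem[of _ _ _ j])
  moreover have "crt n u x j mod 2 = (u j + 2 * (u j + 2 * rep3 (x j))) mod 2"
    using assms(2) by (simp add: crt_def mod_mod_cancel algebra_simps)
  moreover have "\<dots> = u j mod 2" by (rule mod_mult_self2)
  ultimately show ?thesis by auto
qed

lemma dec3_crt:
  assumes "x \<in> vecs n"
  shows "dec3 n (crt n u x) = x"
proof (rule vecs_eqI[OF _ assms])
  fix j assume j: "j < n"
  have "(3 * u j + 4 * rep3 (x j)) mod 6 mod 3 = (3 * (u j + rep3 (x j)) + rep3 (x j)) mod 3"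
    by (simp add: mod_mod_cancel algebra_simps)
  also have "\<dots> = rep3 (x j) mod 3" by (rule mod_mult_self4)
  finally have "(3 * u j + 4 * rep3 (x j)) mod 6 mod 3 = rep3 (x j) mod 3" .
  then have "(of_int ((3 * u j + 4 * rep3 (x j)) mod 6) :: 3) = of_int (rep3 (x j))"
    by (simp only: of_int_3_eq_iff)
  then show "dec3 n (crt n u x) j = x j" using j by (simp add: dec3_def crt_def)
qed simp

lemma crt_unique:
  assumes "f \<in> carrier (Zmn 6 n)" "\<And>j. j < n \<Longrightarrow> f j mod 2 = u j" "\<And>j. j < n \<Longrightarrow> of_int (f j) = x j"
  shows "f = crt n u x"
proof (rule PiE_ext)
  show f: "f \<in> {..<n} \<rightarrow>\<^sub>E {0..<6}" "crt n u x \<in> {..<n} \<rightarrow>\<^sub>E {0..<6}"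
    using assms(1) crt_in_carrier[of n u x] by (simp_all add: carrier_Zmn)
  fix j assume "j \<in> {..<n}"
  then have j: "j < n" by simp
  have r: "rep3 (x j) = f j mod 3" using assms(3)[OF j] rep3_of_int by metis
  have "0 \<le> f j" "f j < 6" using PiE_mem[OF f(1), of j] j by auto
  then have "f j \<in> {0, 1, 2, 3, 4, 5}" by auto
  then have "(3 * (f j mod 2) + 4 * (f j mod 3)) mod 6 = f j" by auto
  then show "f j = crt n u x j" using j r assms(2)[OF j] by (simp add: crt_def)
qed

lemma inj_on_crt: "inj_on (\<lambda>(u, x). crt n u x) (({..<n} \<rightarrow>\<^sub>E {0, 1}) \<times> vecs n)"
proof (rule inj_onI, clarify)
  fix u v x y
  assume u: "u \<in> {..<n} \<rightarrow>\<^sub>E {0, 1}" and v: "v \<in> {..<n} \<rightarrow>\<^sub>E {0, 1}"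
    and xy: "x \<in> vecs n" "y \<in> vecs n" and eq: "crt n u x = crt n v y"
  have "u = v"
  proof (rule PiE_ext[OF u v])
    fix j assume "j \<in> {..<n}"
    then show "u j = v j" using crt_mod_2[OF u, of j x] crt_mod_2[OF v, of j y] eq by simp
  qed
  moreover have "x = y" using dec3_crt[OF xy(1), of u] dec3_crt[OF xy(2), of v] eq by simp
  ultimately show "u = v \<and> x = y" by simp
qed

lemma card_binary_vecs: "card ({..<n} \<rightarrow>\<^sub>E {0, 1::int}) = 2 ^ n"
  by (simp add: card_PiE numeral_2_eq_2)

text \<open>Every binary part is combined with every point of one maximum cap; reduction modulo 3
  maps the resulting set back into that cap.\<close>

theorem r_ap_6_ge: "2 ^ n * r_ap 3 (Zmn 3 n) \<le> r_ap 6 (Zmn 6 n)"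
proof -
  obtain C where C: "C \<subseteq> vecs n" "cap_on n C" "card C = r_ap 3 (Zmn 3 n)"
    by (rule r_ap_3_cap)
  let ?I = "({..<n} \<rightarrow>\<^sub>E {0, 1::int}) \<times> C"
  let ?A = "(\<lambda>(u, x). crt n u x) ` ?I"
  have dec: "dec3 n ` ?A \<subseteq> C" using C(1) by (auto simp: dec3_crt)
  have sub: "?A \<subseteq> carrier (Zmn 6 n)" using crt_in_carrier by auto
  have "\<not> contains_ap (Zmn 6 n) 6 ?A"
    by (rule notI, rule cap_on_imp_no_ap[OF _ _ C(2) sub dec]) simp_all
  then have "card ?A \<le> r_ap 6 (Zmn 6 n)"
    by (intro r_ap_ge finite_carrier_Zmn sub) simp_all
  moreover have "card ?A = card ?I"
    using C(1) by (intro card_image inj_on_subset[OF inj_on_crt]) auto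
  ultimately show ?thesis by (simp add: card_cartesian_product card_binary_vecs C(3))
qed

text \<open>A progression that alternates between the slices \<open>u\<close> and \<open>v\<close>
  while running cyclically along the line meets all six combinations, since 2 and 3 are
  coprime.\<close>

lemma slices_line_disjoint:
  assumes A: "\<not> contains_ap (Zmn 6 n) 6 A"
    and u: "u \<in> {..<n} \<rightarrow>\<^sub>E {0, 1}" and v: "v \<in> {..<n} \<rightarrow>\<^sub>E {0, 1}"
    and pq: "p \<in> vecs n" "q \<in> vecs n" "p \<noteq> q"
    and in_A: "\<And>x. x \<in> {p, q, third n p q} \<Longrightarrow> crt n u x \<in> A \<and> crt n v x \<in> A"
  shows "u = v"
proof (rule ccontr)
  assume "u \<noteq> v"
  define W where "W i = (if even i then u else v)" for i :: nat
  define X where "X i = (if i mod 3 = 0 then p else if i mod 3 = 1 then q else third n p q)" for i :: nat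
  define a where "a = crt n u p"
  \<comment> \<open>The difference from the point p in slice u to the point q in slice v moves both
    components at once: the binary part follows \<open>W\<close>, the ternary part
    \<open>X\<close>.\<close>
  define d where "d = (\<lambda>j\<in>{..<n}. (crt n v q j - crt n u p j) mod 6)"
  let ?t = "ap_term (Zmn 6 n) a d"
  have W: "W i \<in> {..<n} \<rightarrow>\<^sub>E {0, 1}" for i using u v by (simp add: W_def)
  have X: "X i \<in> vecs n" for i using pq by (simp add: X_def)
  have t: "?t i = crt n (W i) (X i)" for i
  proof (rule crt_unique)
    show "?t i \<in> carrier (Zmn 6 n)" by (simp add: ap_term_Zmn carrier_Zmn)
    fix j assume j: "j < n"
    have uv: "u j = 0 \<or> u j = 1" "v j = 0 \<or> v j = 1"
      using u v j by (auto dest!: PiE_mem[of _ _ _ j])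
    have d2: "d j mod 2 = (v j - u j) mod 2"
    proof -
      have "d j mod 2 = (crt n v q j - crt n u p j) mod 2"
        using j by (simp add: d_def mod_mod_cancel)
      also have "\<dots> = (crt n v q j mod 2 - crt n u p j mod 2) mod 2" by (simp add: mod_simps)
      finally show ?thesis by (simp add: crt_mod_2[OF u j] crt_mod_2[OF v j])
    qed
    have "?t i j mod 2 = (a j + int i * d j) mod 2"
      using j by (simp add: ap_term_Zmn mod_mod_cancel)
    also have "\<dots> = (a j mod 2 + (int i mod 2) * (d j mod 2)) mod 2"
      by (intro mod_add_cong mod_mult_cong) simp_all
    also have "\<dots> = (u j + (int i mod 2) * ((v j - u j) mod 2)) mod 2"
      by (simp add: a_def crt_mod_2[OF u j] d2)
    also have "\<dots> = W i j"
    proof (cases "even i")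
      case True
      then have "int i mod 2 = 0" by (simp flip: even_iff_mod_2_eq_zero)
      then show ?thesis using uv True by (auto simp: W_def)
    next
      case False
      then have "int i mod 2 = 1" by (simp flip: odd_iff_mod_2_eq_one)
      then show ?thesis using uv False by (auto simp: W_def)
    qed
    finally show "?t i j mod 2 = W i j" .
    have a3: "of_int (a j) = p j" using fun_cong[OF dec3_crt[OF pq(1), of u], of j] j by (simp add: a_def dec3_def)
    have d3: "of_int (d j) = q j - p j"
    proof -
      have "d j mod 3 = (crt n v q j - crt n u p j) mod 3"
        using j by (simp add: d_def mod_mod_cancel)
      then have "(of_int (d j) :: 3) = of_int (crt n v q j - crt n u p j)"
        by (simp only: of_int_3_eq_iff)
      then show ?thesis
        using fun_cong[OF dec3_crt[OF pq(1), of u], of j] fun_cong[OF dec3_crt[OF pq(2), of v], of j] j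
        by (simp add: dec3_def)
    qed
    have "int i mod 3 = int (i mod 3) mod 3" by (simp add: zmod_int)
    then have "(of_int (int i) :: 3) = of_int (int (i mod 3))" by (simp only: of_int_3_eq_iff)
    then have "(of_nat i :: 3) = of_nat (i mod 3)" by (simp only: of_int_of_nat_eq)
    moreover have "i mod 3 = 0 \<or> i mod 3 = 1 \<or> i mod 3 = 2" by presburger
    moreover have "b + 2 * (c - b) = - (b + c)" for b c :: 3
      by (cases b rule: three_cases; cases c rule: three_cases; simp)
    ultimately have "p j + of_nat i * (q j - p j) = X i j"
      using j by (auto simp: X_def third_def)
    moreover have "of_int (?t i j) = p j + of_nat i * (q j - p j)"
      using dec3_ap_term[of 6 j n a d i] j by (simp add: dec3_def a3 d3)
    ultimately show "of_int (?t i j) = X i j" by simp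
  qed
  have "\<forall>i<n. p i + q i + third n p q i = 0" by (simp add: third_def)
  from sum_zero_distinct[OF pq(1,2) third_in_vecs this] pq(3)
  have dist: "q \<noteq> third n p q" "p \<noteq> third n p q" by auto
  have "inj_on ?t {..<6}"
  proof (rule inj_onI)
    fix i k assume ik: "i \<in> {..<6}" "k \<in> {..<6}" and eq: "?t i = ?t k"
    have "W i = W k \<and> X i = X k"
      using inj_onD[OF inj_on_crt, of n "(W i, X i)" "(W k, X k)"] eq W X by (simp add: t)
    then have "even i \<longleftrightarrow> even k" "i mod 3 = k mod 3"
      using \<open>u \<noteq> v\<close> dist pq(3) by (auto simp: W_def X_def split: if_splits)
    moreover have "i \<in> {0, 1, 2, 3, 4, 5}" "k \<in> {0, 1, 2, 3, 4, 5}" using ik by auto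
    ultimately show "i = k" by auto
  qed
  moreover have "?t i \<in> A" for i
    using in_A[of "X i"] by (auto simp: t W_def X_def)
  moreover have "a \<in> carrier (Zmn 6 n)" by (simp add: a_def crt_in_carrier)
  moreover have "d \<in> carrier (Zmn 6 n)" by (simp add: d_def carrier_Zmn)
  ultimately have "contains_ap (Zmn 6 n) 6 A" unfolding contains_ap_def by blast
  with A show False ..
qed

text \<open>The slices \<open>B u\<close> of an extremal set form a family to which the averaging
  bound applies, with \<open>K\<close> supplied by the slice rank bound. The auxiliary dimension
  \<open>m\<close> remains free for optimisation.\<close>

theorem r_ap_6_le:
  "3 ^ m * r_ap 6 (Zmn 6 n) \<le> 6 ^ n * (3 * card (low_degree m)) + 9 ^ m * (3 ^ n + 2 ^ n)"
proof -
  obtain A where A: "A \<subseteq> carrier (Zmn 6 n)" "\<not> contains_ap (Zmn 6 n) 6 A" "card A = r_ap 6 (Zmn 6 n)"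
    using r_ap_attained[OF finite_carrier_Zmn, of 6 6 n] by auto
  define U where "U = {..<n} \<rightarrow>\<^sub>E {0, 1::int}"
  have U: "finite U" "card U = 2 ^ n" by (simp_all add: U_def finite_PiE card_binary_vecs)
  define B where "B u = {x \<in> vecs n. crt n u x \<in> A}" for u
  have "card A \<le> card (Sigma U B)"
  proof (rule card_inj_on_le)
    let ?h = "\<lambda>f. ((\<lambda>j\<in>{..<n}. f j mod 2), dec3 n f)"
    have crt: "crt n (fst (?h f)) (snd (?h f)) = f" if "f \<in> A" for f
      using that A(1) by (intro crt_unique[symmetric]) (auto simp: dec3_def)
    show "inj_on ?h A" using crt by (intro inj_on_inverseI[of _ "\<lambda>p. crt n (fst p) (snd p)"]) blast
    show "?h ` A \<subseteq> Sigma U B"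
    proof (rule image_subsetI)
      fix f assume "f \<in> A"
      moreover have "(\<lambda>j\<in>{..<n}. f j mod 2) \<in> U" unfolding U_def by (intro PiE_I) auto
      ultimately show "?h f \<in> Sigma U B" using crt[of f] by (simp add: B_def)
    qed
    show "finite (Sigma U B)" using U by (auto simp: B_def)
  qed
  also have "\<dots> = (\<Sum>u\<in>U. card (B u))" using U by (intro card_SigmaI) (auto simp: B_def)
  finally have "3 ^ m * card A \<le> 3 ^ m * (\<Sum>u\<in>U. card (B u))" by simp
  also have "\<dots> \<le> card U * 3 ^ n * (3 * card (low_degree m)) + 9 ^ m * (3 ^ n + card U)"
  proof (rule sum_card_line_disjoint_family)
    show "u = v" if "u \<in> U" "v \<in> U" "p \<noteq> q" "{p, q, third n p q} \<subseteq> B u" "{p, q, third n p q} \<subseteq> B v" for u v p q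
      using that A(2) by (intro slices_line_disjoint[of n A u v p q]) (auto simp: U_def B_def)
    show "card C \<le> 3 * card (low_degree m)" if "C \<subseteq> vecs m" "cap_on m C" for C
      using card_cap_on that by (simp add: vecs_def)
  qed (use U in \<open>auto simp: B_def\<close>)
  finally show ?thesis
    by (simp add: A(3) U flip: power_mult_distrib)
qed

section \<open>Asymptotic form of the upper bound\<close>

text \<open>Reduces an asymptotic claim with rounding \<open>n div k\<close> to one numerical
  inequality: each full block of \<open>k\<close> steps gains the factor \<open>\<rho> < 1\<close>,
  which eventually absorbs all constants.\<close>

lemma eventually_power_bound:
  fixes a b c C :: real
  assumes pos: "0 < a" "0 < b" "0 < c" "0 < C" and k: "0 < k" and lt: "a ^ k * b ^ l < c ^ k"
  shows "\<forall>\<^sub>F n in sequentially. C * a ^ n * b ^ (l * (n div k)) \<le> c ^ n"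
proof -
  define \<rho> where "\<rho> = a ^ k * b ^ l / c ^ k"
  \<comment> \<open>\<open>R ^ k\<close> bounds the contribution of the remainder
    \<open>n mod k\<close> whatever its value.\<close>
  define R where "R = max 1 (a / c)"
  have \<rho>: "0 < \<rho>" "\<rho> < 1" using pos lt by (simp_all add: \<rho>_def)
  have "(\<lambda>s. C * R ^ k * \<rho> ^ s) \<longlonglongrightarrow> C * R ^ k * 0"
    using \<rho> by (intro tendsto_mult LIMSEQ_power_zero tendsto_const) simp
  then have "\<forall>\<^sub>F s in sequentially. C * R ^ k * \<rho> ^ s < 1"
    by (rule order_tendstoD) simp
  then have "\<forall>\<^sub>F n in sequentially. C * R ^ k * \<rho> ^ (n div k) < 1"
    by (rule eventually_compose_filterlim) (use k in \<open>rule filterlim_at_top_div_const_nat\<close>)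
  then show ?thesis
  proof (rule eventually_mono)
    fix n assume small: "C * R ^ k * \<rho> ^ (n div k) < 1"
    define s r where "s = n div k" and "r = n mod k"
    have n: "n = k * s + r" by (simp add: s_def r_def)
    have "(a / c) ^ r \<le> R ^ r" using pos by (intro power_mono) (simp_all add: R_def)
    also have "\<dots> \<le> R ^ k" using k by (intro power_increasing) (simp_all add: R_def r_def less_imp_le)
    finally have R: "(a / c) ^ r \<le> R ^ k" .
    have "C * a ^ n * b ^ (l * s) = C * (a / c) ^ r * \<rho> ^ s * c ^ n"
      using pos by (simp add: n \<rho>_def power_add power_mult power_divide power_mult_distrib)
    also have "\<dots> \<le> C * R ^ k * \<rho> ^ s * c ^ n"
      using pos \<rho> R by (intro mult_right_mono mult_left_mono) simp_all
    also have "\<dots> \<le> 1 * c ^ n"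
      using small pos by (intro mult_right_mono) (simp_all add: s_def)
    finally show "C * a ^ n * b ^ (l * (n div k)) \<le> c ^ n" by (simp add: s_def)
  qed
qed

theorem eventually_r_ap_6_le: "\<forall>\<^sub>F n in sequentially. real (r_ap 6 (Zmn 6 n)) \<le> 5.709 ^ n"
proof -
  \<comment> \<open>\<open>r_ap_6_le\<close> is used with \<open>m\<close> about \<open>\<mu> n\<close>: both terms are small enough only for \<open>\<mu>\<close> between
    0.5841 and 0.5856, and 24/41 lies there.\<close>
  have "\<forall>\<^sub>F n in sequentially. 6 * 6 ^ n * 0.9184 ^ (24 * (n div 41)) \<le> (5.709 :: real) ^ n"
    by (rule eventually_power_bound) (simp_all add: power_divide)
  \<comment> \<open>The leading factors 6 and 4 are twice the coefficients 3 and 2 needed below, so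
    each term uses up half of \<open>5.709 ^ n\<close>.\<close>
  moreover have "\<forall>\<^sub>F n in sequentially. 4 * 3 ^ n * 3 ^ (24 * (n div 41)) \<le> (5.709 :: real) ^ n"
    by (rule eventually_power_bound) (simp_all add: power_divide)
  ultimately show ?thesis
  proof eventually_elim
    case (elim n)
    define m where "m = 24 * (n div 41)"
    have "(3::real) ^ m * real (r_ap 6 (Zmn 6 n)) = real (3 ^ m * r_ap 6 (Zmn 6 n))" by simp
    also have "\<dots> \<le> real (6 ^ n * (3 * card (low_degree m)) + 9 ^ m * (3 ^ n + 2 ^ n))"
      using r_ap_6_le of_nat_le_iff by blast
    also have "\<dots> = 6 ^ n * (3 * real (card (low_degree m))) + 9 ^ m * (3 ^ n + 2 ^ n)" by simp
    also have "\<dots> \<le> 6 ^ n * (3 * 2.7552 ^ m) + 9 ^ m * (3 ^ n + 3 ^ n)"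
      by (intro add_mono mult_left_mono card_low_degree order_refl power_mono) simp_all
    \<comment> \<open>0.9184 is 2.7552 / 3; the factor \<open>3 ^ m\<close> is split off to be
      cancelled.\<close>
    also have "(2.7552::real) ^ m = 3 ^ m * 0.9184 ^ m" by (simp flip: power_mult_distrib)
    also have "(9::real) ^ m = 3 ^ m * 3 ^ m" by (simp flip: power_mult_distrib)
    also have "6 ^ n * (3 * (3 ^ m * 0.9184 ^ m)) + 3 ^ m * 3 ^ m * (3 ^ n + 3 ^ n) =
        3 ^ m * (3 * 6 ^ n * 0.9184 ^ m + 2 * 3 ^ n * 3 ^ m :: real)" by (simp add: algebra_simps)
    finally have "real (r_ap 6 (Zmn 6 n)) \<le> 3 * 6 ^ n * 0.9184 ^ m + 2 * 3 ^ n * 3 ^ m" by simp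
    with elim show ?case by (simp add: m_def)
  qed
qed

section \<open>Edel's extended product construction\<close>

text \<open>Stated over an arbitrary group type, so that products can be iterated by nesting
  function types.\<close>

definition is_cap :: "'v::ab_group_add set \<Rightarrow> bool" where
  "is_cap A \<longleftrightarrow> (\<forall>x\<in>A. \<forall>y\<in>A. \<forall>z\<in>A. x + y + z = 0 \<longrightarrow> x = y \<and> y = z)"

definition sum_avoiding :: "'v::ab_group_add set \<Rightarrow> 'v set \<Rightarrow> 'v set \<Rightarrow> bool" where
  "sum_avoiding A B C \<longleftrightarrow> (\<forall>x\<in>A. \<forall>y\<in>B. \<forall>z\<in>C. x + y + z \<noteq> 0)"

text \<open>The letters \<open>None\<close>, \<open>Some False\<close>, \<open>Some True\<close> are the symbols 0, 1, 2 of Edel's extended product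
  construction. The multisets of letters that exclude a zero sum are 001, 002 and 012.\<close>

definition extendable :: "(bool option \<Rightarrow> 'v::ab_group_add set) \<Rightarrow> bool" where
  "extendable A \<longleftrightarrow> (\<forall>l. is_cap (A l)) \<and> (\<forall>b. sum_avoiding (A None) (A None) (A (Some b)))
     \<and> sum_avoiding (A None) (A (Some False)) (A (Some True))"

fun separates :: "bool option \<Rightarrow> bool option \<Rightarrow> bool option \<Rightarrow> bool" where
  "separates None None c \<longleftrightarrow> c \<noteq> None"
| "separates None (Some b) c \<longleftrightarrow> c \<noteq> Some b"
| "separates (Some a) None c \<longleftrightarrow> c \<noteq> Some a"
| "separates (Some a) (Some b) c \<longleftrightarrow> c = None \<and> a \<noteq> b"

text \<open>\<open>extendable\<close> fixes one order for each multiset of letters,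
  \<open>separates\<close> allows all orders; commutativity of addition bridges the two.\<close>

lemma separates_imp_sum_nonzero:
  assumes A: "extendable A" and s: "separates a b c" and xyz: "x \<in> A a" "y \<in> A b" "z \<in> A c"
  shows "x + y + z \<noteq> 0"
proof -
  have 1: "p + q + r \<noteq> 0" if "p \<in> A None" "q \<in> A None" "r \<in> A (Some d)" for p q r d
    using A that by (auto simp: extendable_def sum_avoiding_def)
  have 2: "p + q + r \<noteq> 0" if "p \<in> A None" "q \<in> A (Some d)" "r \<in> A (Some e)" "d \<noteq> e" for p q r d e
  proof (cases d)
    case True
    then have "p + r + q \<noteq> 0" using A that by (auto simp: extendable_def sum_avoiding_def)
    then show ?thesis by (simp add: ac_simps)
  next
    case False
    then show ?thesis using A that by (auto simp: extendable_def sum_avoiding_def)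
  qed
  have perms: "y + z + x = x + y + z" "x + z + y = x + y + z" "y + x + z = x + y + z" "z + x + y = x + y + z"
    by (simp_all add: ac_simps)
  note one = 1[where p = x and q = y and r = z] 1[where p = y and q = z and r = x, unfolded perms]
    1[where p = x and q = z and r = y, unfolded perms]
  note two = 2[where p = x and q = y and r = z] 2[where p = y and q = x and r = z, unfolded perms]
    2[where p = z and q = x and r = y, unfolded perms]
  show ?thesis
  proof
    assume "x + y + z = 0"
    then show False using s xyz one two by (cases a; cases b; cases c) auto
  qed
qed

definition word_prod :: "('l \<Rightarrow> 'v set) \<Rightarrow> ('i \<Rightarrow> 'l) \<Rightarrow> ('i \<Rightarrow> 'v) set" where
  "word_prod A w = {x. \<forall>i. x i \<in> A (w i)}"

lemma
  fixes w :: "'i::finite \<Rightarrow> 'l"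
  assumes "\<And>l. finite (A l)"
  shows finite_word_prod: "finite (word_prod A w)"
    and card_word_prod: "card (word_prod A w) = (\<Prod>i\<in>UNIV. card (A (w i)))"
proof -
  have eq: "word_prod A w = PiE UNIV (\<lambda>i. A (w i))" by (auto simp: word_prod_def PiE_def)
  show "finite (word_prod A w)" "card (word_prod A w) = (\<Prod>i\<in>UNIV. card (A (w i)))"
    using assms by (simp_all add: eq card_PiE finite_PiE)
qed

text \<open>Triples with two equal words are included; they make the products of different words
  disjoint.\<close>

definition admissible :: "'s set \<Rightarrow> ('s \<Rightarrow> 'i \<Rightarrow> bool option) \<Rightarrow> bool" where
  "admissible S w \<longleftrightarrow> (\<forall>s\<in>S. \<forall>t\<in>S. \<forall>u\<in>S. \<not> (s = t \<and> t = u) \<longrightarrow> (\<exists>i. separates (w s i) (w t i) (w u i)))"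

lemma admissibleD:
  assumes "admissible S w" "s \<in> S" "t \<in> S" "u \<in> S" "\<not> (s = t \<and> t = u)"
  obtains i where "separates (w s i) (w t i) (w u i)"
  using assms unfolding admissible_def by blast

lemma word_prod_sum_nonzero:
  assumes "extendable A" "x \<in> word_prod A v" "y \<in> word_prod A w" "z \<in> word_prod A w'"
    and "separates (v i) (w i) (w' i)"
  shows "x + y + z \<noteq> 0"
proof
  assume "x + y + z = 0"
  then have "x i + y i + z i = 0" by (metis plus_fun_apply zero_fun_apply)
  moreover have "x i \<in> A (v i)" "y i \<in> A (w i)" "z i \<in> A (w' i)" using assms by (auto simp: word_prod_def)
  ultimately show False using separates_imp_sum_nonzero[OF assms(1,5)] by blast
qed

lemma is_cap_word_prod:
  assumes "extendable A"
  shows "is_cap (word_prod A w)"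
  unfolding is_cap_def
proof (intro ballI impI)
  fix x y z assume mem: "x \<in> word_prod A w" "y \<in> word_prod A w" "z \<in> word_prod A w" and "x + y + z = 0"
  then have sum0: "x i + y i + z i = 0" for i by (metis plus_fun_apply zero_fun_apply)
  have "is_cap (A (w i))" for i using assms by (simp add: extendable_def)
  moreover have "x i \<in> A (w i)" "y i \<in> A (w i)" "z i \<in> A (w i)" for i using mem by (auto simp: word_prod_def)
  ultimately have "x i = y i \<and> y i = z i" for i unfolding is_cap_def using sum0 by blast
  then show "x = y \<and> y = z" by auto
qed

text \<open>A separated position rules out zero sums across words that are not all equal; within one
  word the product of caps is a cap.\<close>

lemma is_cap_Union_word_prod:
  assumes A: "extendable A" and S: "admissible S w"
  shows "is_cap (\<Union>s\<in>S. word_prod A (w s))"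
  unfolding is_cap_def
proof (intro ballI impI)
  fix x y z assume "x \<in> (\<Union>s\<in>S. word_prod A (w s))" "y \<in> (\<Union>s\<in>S. word_prod A (w s))"
    "z \<in> (\<Union>s\<in>S. word_prod A (w s))" and sum0: "x + y + z = 0"
  then obtain s t u where stu: "s \<in> S" "t \<in> S" "u \<in> S"
    and xyz: "x \<in> word_prod A (w s)" "y \<in> word_prod A (w t)" "z \<in> word_prod A (w u)" by blast
  have "s = t \<and> t = u"
  proof (rule ccontr)
    assume "\<not> (s = t \<and> t = u)"
    then obtain i where "separates (w s i) (w t i) (w u i)"
      using admissibleD[OF S stu] by blast
    from word_prod_sum_nonzero[OF A xyz this] sum0 show False by simp
  qed
  then show "x = y \<and> y = z"
    using is_cap_word_prod[OF A, of "w s"] xyz sum0 by (auto simp: is_cap_def)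
qed

text \<open>A point \<open>x\<close> common to two products would give the zero sum
  \<open>x + x + x\<close> across a separated triple.\<close>

lemma card_Union_word_prod:
  fixes A :: "bool option \<Rightarrow> 'v::ab_group_add set" and w :: "'s \<Rightarrow> 'i::finite \<Rightarrow> bool option"
  assumes A: "extendable A" and fin: "\<And>l. finite (A l)" and S: "admissible S w" "finite S"
    and torsion: "\<And>x :: 'v. x + x + x = 0"
  shows "card (\<Union>s\<in>S. word_prod A (w s)) = (\<Sum>s\<in>S. \<Prod>i\<in>UNIV. card (A (w s i)))"
proof -
  have "word_prod A (w s) \<inter> word_prod A (w t) = {}" if st: "s \<in> S" "t \<in> S" "s \<noteq> t" for s t
  proof (rule ccontr)
    assume "word_prod A (w s) \<inter> word_prod A (w t) \<noteq> {}"
    then obtain x where x: "x \<in> word_prod A (w s)" "x \<in> word_prod A (w t)" by blast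
    obtain i where "separates (w s i) (w s i) (w t i)"
      using admissibleD[OF S(1) st(1,1,2)] st(3) by blast
    from word_prod_sum_nonzero[OF A x(1) x(1) x(2) this] torsion show False
      by (auto simp: fun_eq_iff)
  qed
  then show ?thesis
    using S fin by (subst card_UN_disjoint) (auto simp: card_word_prod finite_word_prod)
qed

section \<open>First round: words with a single zero\<close>

text \<open>In Edel's notation the word 2...2 0 1...1 with its zero at position
  \<open>k\<close>.\<close>

definition one_hole_word :: "'i::linorder \<Rightarrow> 'i \<Rightarrow> bool option" where
  "one_hole_word k i = (if i = k then None else Some (i < k))"

text \<open>The new triple of sets for the next round: the union over all one-zero words plays the
  role of 0, the constant words those of 1 and 2.\<close>

definition one_hole_level :: "(bool option \<Rightarrow> 'v set) \<Rightarrow> bool option \<Rightarrow> ('i::linorder \<Rightarrow> 'v) set" where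
  "one_hole_level A l = (case l of None \<Rightarrow> (\<Union>k. word_prod A (one_hole_word k)) | Some b \<Rightarrow> word_prod A (\<lambda>_. Some b))"

text \<open>At the middle one of three distinct holes the letters are 0, 1, 2 in some order. If two
  holes agree and the third differs, the common hole shows 0, 0 and a nonzero letter.\<close>

lemma admissible_one_hole: "admissible UNIV (one_hole_word :: 'i::linorder \<Rightarrow> _)"
  unfolding admissible_def
proof (intro ballI impI)
  fix a b c :: 'i assume ne: "\<not> (a = b \<and> b = c)"
  consider "a = b" "c \<noteq> a" | "a = c" "b \<noteq> a" | "b = c" "a \<noteq> b"
    | "a < b" "b < c" | "c < b" "b < a" | "b < a" "a < c" | "c < a" "a < b" | "a < c" "c < b" | "b < c" "c < a"
    using ne by (cases a b rule: linorder_cases; cases b c rule: linorder_cases; cases a c rule: linorder_cases; simp)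
  then show "\<exists>i. separates (one_hole_word a i) (one_hole_word b i) (one_hole_word c i)"
  proof cases
    case 1 then show ?thesis by (intro exI[of _ a]) (simp add: one_hole_word_def)
  next
    case 2 then show ?thesis by (intro exI[of _ a]) (simp add: one_hole_word_def)
  next
    case 3 then show ?thesis by (intro exI[of _ b]) (simp add: one_hole_word_def)
  next
    case 4 then show ?thesis by (intro exI[of _ b]) (auto simp: one_hole_word_def)
  next
    case 5 then show ?thesis by (intro exI[of _ b]) (auto simp: one_hole_word_def)
  next
    case 6 then show ?thesis by (intro exI[of _ a]) (auto simp: one_hole_word_def)
  next
    case 7 then show ?thesis by (intro exI[of _ a]) (auto simp: one_hole_word_def)
  next
    case 8 then show ?thesis by (intro exI[of _ c]) (auto simp: one_hole_word_def)
  next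
    case 9 then show ?thesis by (intro exI[of _ c]) (auto simp: one_hole_word_def)
  qed
qed

lemma extendable_one_hole_level:
  assumes A: "extendable A"
  shows "extendable (one_hole_level A :: _ \<Rightarrow> ('i::linorder \<Rightarrow> 'v::ab_group_add) set)"
  unfolding extendable_def
proof (intro conjI allI)
  let ?L = "one_hole_level A :: _ \<Rightarrow> ('i \<Rightarrow> 'v) set"
  show "is_cap (?L l)" for l
    by (cases l) (simp_all add: one_hole_level_def is_cap_word_prod[OF A] is_cap_Union_word_prod[OF A admissible_one_hole])
  show "sum_avoiding (?L None) (?L None) (?L (Some b))" for b
    unfolding sum_avoiding_def
  proof (intro ballI)
    fix x y z assume "x \<in> ?L None" "y \<in> ?L None" "z \<in> ?L (Some b)"
    then obtain j k where xyz: "x \<in> word_prod A (one_hole_word j)" "y \<in> word_prod A (one_hole_word k)"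
        "z \<in> word_prod A (\<lambda>_. Some b)"
      by (auto simp: one_hole_level_def)
    \<comment> \<open>At the larger of two different holes the other word has letter 1, at the
      smaller one letter 2; \<open>i\<close> is the hole where that letter differs from
      \<open>b\<close>.\<close>
    define i where "i = (if b \<longleftrightarrow> j < k then k else j)"
    have "separates (one_hole_word j i) (one_hole_word k i) (Some b)"
      by (cases b; cases j k rule: linorder_cases) (auto simp: i_def one_hole_word_def)
    from word_prod_sum_nonzero[OF A xyz this] show "x + y + z \<noteq> 0" .
  qed
  show "sum_avoiding (?L None) (?L (Some False)) (?L (Some True))"
    unfolding sum_avoiding_def
  proof (intro ballI)
    fix x y z assume "x \<in> ?L None" "y \<in> ?L (Some False)" "z \<in> ?L (Some True)"
    then obtain k where xyz: "x \<in> word_prod A (one_hole_word k)" "y \<in> word_prod A (\<lambda>_. Some False)"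
        "z \<in> word_prod A (\<lambda>_. Some True)"
      by (auto simp: one_hole_level_def)
    have "separates (one_hole_word k k) (Some False) (Some True)" by (simp add: one_hole_word_def)
    from word_prod_sum_nonzero[OF A xyz this] show "x + y + z \<noteq> 0" .
  qed
qed

lemma
  fixes A :: "bool option \<Rightarrow> 'v::ab_group_add set"
  assumes A: "extendable A" and fin: "\<And>l. finite (A l)" and torsion: "\<And>x :: 'v. x + x + x = 0"
    and c: "\<And>b. card (A (Some b)) = c"
  shows card_one_hole_level_None:
      "card (one_hole_level A None :: ('i::{finite,linorder} \<Rightarrow> 'v) set) = CARD('i) * (card (A None) * c ^ (CARD('i) - 1))"
    and card_one_hole_level_Some:
      "card (one_hole_level A (Some b) :: ('i \<Rightarrow> 'v) set) = c ^ CARD('i)"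
proof -
  have "(\<Prod>i\<in>UNIV. card (A (one_hole_word k i))) = card (A None) * c ^ (CARD('i) - 1)" for k :: 'i
    by (subst prod.remove[of _ k]) (simp_all add: one_hole_word_def c)
  then show "card (one_hole_level A None :: ('i \<Rightarrow> 'v) set) = CARD('i) * (card (A None) * c ^ (CARD('i) - 1))"
    by (simp add: one_hole_level_def card_Union_word_prod[OF A fin admissible_one_hole finite torsion])
  show "card (one_hole_level A (Some b) :: ('i \<Rightarrow> 'v) set) = c ^ CARD('i)"
    by (simp add: one_hole_level_def card_word_prod[OF fin] c)
qed

text \<open>The letter at a nonzero position \<open>p\<close> is the parity of the number of \<open>z \<in> Z\<close> with \<open>T p z\<close>. Over a
  common kernel these parities cancel, so that a coincidence between three words only involves the
  pairwise disjoint petals \<open>Z - K\<close>.\<close>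

definition parity_word :: "('j \<Rightarrow> 'j \<Rightarrow> bool) \<Rightarrow> 'j set \<Rightarrow> 'j \<Rightarrow> bool option" where
  "parity_word T Z p = (if p \<in> Z then None else Some (odd (card {z\<in>Z. T p z})))"

lemma odd_card_Un_disjoint:
  assumes "finite K" "finite P" "K \<inter> P = {}"
  shows "odd (card {z\<in>K \<union> P. T z}) \<longleftrightarrow> odd (card {z\<in>K. T z}) \<noteq> odd (card {z\<in>P. T z})"
proof -
  have "{z\<in>K \<union> P. T z} = {z\<in>K. T z} \<union> {z\<in>P. T z}" by auto
  moreover have "card ({z\<in>K. T z} \<union> {z\<in>P. T z}) = card {z\<in>K. T z} + card {z\<in>P. T z}"
    using assms by (intro card_Un_disjoint) auto
  ultimately show ?thesis by simp
qed

lemma odd_card_singleton: "odd (card {z\<in>{q}. T z}) \<longleftrightarrow> T q"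
proof -
  have "{z\<in>{q}. T z} = (if T q then {q} else {})" by auto
  then show ?thesis by simp
qed

lemma odd_card_pair:
  assumes "q \<noteq> r"
  shows "odd (card {z\<in>{q, r}. T z}) \<longleftrightarrow> T q \<noteq> T r"
proof -
  have "odd (card {z\<in>{q} \<union> {r}. T z}) \<longleftrightarrow> T q \<noteq> T r"
    using assms by (subst odd_card_Un_disjoint) (simp_all only: odd_card_singleton, auto)
  then show ?thesis by (simp only: insert_is_Un[of q "{r}"])
qed

text \<open>Without a separating position the three zero sets form a sunflower with kernel
  \<open>K\<close> and equally large petals. Since everything fits into 9 points, the petals have
  size 1 or 2, and these cases are excluded by \<open>T1\<close> and \<open>T2\<close>.\<close>

lemma admissible_parity_word:
  fixes T :: "'j::finite \<Rightarrow> 'j \<Rightarrow> bool"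
  assumes card9: "CARD('j) = 9"
    and T1: "\<And>x y z. distinct [x, y, z] \<Longrightarrow> \<not> (T x y = T x z \<and> T y x = T y z \<and> T z x = T z y)"
    and T2: "\<And>p p' q q' r r'. distinct [p, p', q, q', r, r'] \<Longrightarrow>
      \<not> ((\<forall>x\<in>{p, p'}. (T x q \<noteq> T x q') = (T x r \<noteq> T x r')) \<and> (\<forall>x\<in>{q, q'}. (T x p \<noteq> T x p') = (T x r \<noteq> T x r')) \<and>
         (\<forall>x\<in>{r, r'}. (T x p \<noteq> T x p') = (T x q \<noteq> T x q')))"
  shows "admissible {Z. card Z = 4} (parity_word T)"
  unfolding admissible_def
proof (intro ballI impI, rule ccontr)
  fix Z1 Z2 Z3 :: "'j set"
  assume "Z1 \<in> {Z. card Z = 4}" "Z2 \<in> {Z. card Z = 4}" "Z3 \<in> {Z. card Z = 4}"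
    and ne: "\<not> (Z1 = Z2 \<and> Z2 = Z3)"
    and "\<not> (\<exists>i. separates (parity_word T Z1 i) (parity_word T Z2 i) (parity_word T Z3 i))"
  then have c4: "card Z1 = 4" "card Z2 = 4" "card Z3 = 4"
    and nosep: "\<And>i. \<not> separates (parity_word T Z1 i) (parity_word T Z2 i) (parity_word T Z3 i)" by auto
  define K where "K = Z1 \<inter> Z2 \<inter> Z3"
  define P where "P Z = Z - K" for Z
  \<comment> \<open>A point in exactly two of the zero sets would show the letters 0, 0 and a
    nonzero one.\<close>
  have not2: "i \<in> Z1 \<and> i \<in> Z2 \<longleftrightarrow> i \<in> K" "i \<in> Z1 \<and> i \<in> Z3 \<longleftrightarrow> i \<in> K" "i \<in> Z2 \<and> i \<in> Z3 \<longleftrightarrow> i \<in> K" for i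
    using nosep[of i] by (auto simp: parity_word_def K_def split: if_splits)
  \<comment> \<open>A point in exactly one zero set shows 0 and two nonzero letters, which must be
    equal.\<close>
  have par: "i \<in> Z1 \<Longrightarrow> i \<notin> K \<Longrightarrow> odd (card {z\<in>Z2. T i z}) = odd (card {z\<in>Z3. T i z})"
    "i \<in> Z2 \<Longrightarrow> i \<notin> K \<Longrightarrow> odd (card {z\<in>Z1. T i z}) = odd (card {z\<in>Z3. T i z})"
    "i \<in> Z3 \<Longrightarrow> i \<notin> K \<Longrightarrow> odd (card {z\<in>Z1. T i z}) = odd (card {z\<in>Z2. T i z})" for i
    using nosep[of i] not2[of i] by (auto simp: parity_word_def split: if_splits)
  have Zs: "Z1 = K \<union> P Z1" "Z2 = K \<union> P Z2" "Z3 = K \<union> P Z3" by (auto simp: P_def K_def)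
  have disj: "P Z1 \<inter> P Z2 = {}" "P Z1 \<inter> P Z3 = {}" "P Z2 \<inter> P Z3 = {}" "K \<inter> P Z = {}" for Z
    using not2 by (auto simp: P_def)
  define s where "s = card (P Z1)"
  have sizes: "card K + s = 4" "card (P Z1) = s" "card (P Z2) = s" "card (P Z3) = s"
  proof -
    have eq: "card K + card (P Z) = card Z" if "K \<subseteq> Z" for Z
      using that by (simp add: P_def card_Diff_subset card_mono)
    have "K \<subseteq> Z1" "K \<subseteq> Z2" "K \<subseteq> Z3" by (auto simp: K_def)
    from this[THEN eq] have "card K + card (P Z1) = 4" "card K + card (P Z2) = 4" "card K + card (P Z3) = 4"
      by (simp_all only: c4)
    then show "card K + s = 4" "card (P Z1) = s" "card (P Z2) = s" "card (P Z3) = s"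
      by (simp_all add: s_def)
  qed
  have petal_parity: "odd (card {z\<in>P Z2. T i z}) = odd (card {z\<in>P Z3. T i z})" if "i \<in> P Z1" for i
    using par(1)[of i] that odd_card_Un_disjoint[of K "P Z2" "T i"] odd_card_Un_disjoint[of K "P Z3" "T i"] disj
    by (simp flip: Zs) (auto simp: P_def)
  have petal_parity2: "odd (card {z\<in>P Z1. T i z}) = odd (card {z\<in>P Z3. T i z})" if "i \<in> P Z2" for i
    using par(2)[of i] that odd_card_Un_disjoint[of K "P Z1" "T i"] odd_card_Un_disjoint[of K "P Z3" "T i"] disj
    by (simp flip: Zs) (auto simp: P_def)
  have petal_parity3: "odd (card {z\<in>P Z1. T i z}) = odd (card {z\<in>P Z2. T i z})" if "i \<in> P Z3" for i
    using par(3)[of i] that odd_card_Un_disjoint[of K "P Z1" "T i"] odd_card_Un_disjoint[of K "P Z2" "T i"] disj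
    by (simp flip: Zs) (auto simp: P_def)
  \<comment> \<open>With \<open>card K = 4 - s\<close> the union has 4 + 2s points, hence 4 + 2s is
    at most 9.\<close>
  have "card (K \<union> P Z1 \<union> P Z2 \<union> P Z3) = card K + 3 * s"
    using disj sizes by (simp add: card_Un_disjoint Int_Un_distrib2)
  moreover have "card (K \<union> P Z1 \<union> P Z2 \<union> P Z3) \<le> CARD('j)" by (rule card_mono) auto
  ultimately have "s \<le> 2" using sizes(1) card9 by simp
  moreover have "s \<noteq> 0"
  proof
    assume "s = 0"
    then have "P Z1 = {}" "P Z2 = {}" "P Z3 = {}" using sizes by simp_all
    then show False using Zs ne by simp
  qed
  ultimately consider "s = 1" | "s = 2" by linarith
  then show False
  proof cases
    case 1
    then obtain x y z where xyz: "P Z1 = {x}" "P Z2 = {y}" "P Z3 = {z}"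
      using sizes by (metis card_1_singletonE)
    have "T x y = T x z" "T y x = T y z" "T z x = T z y"
      using petal_parity[of x] petal_parity2[of y] petal_parity3[of z] by (simp_all only: xyz odd_card_singleton) simp_all
    moreover have "distinct [x, y, z]" using disj xyz by auto
    ultimately show False using T1 by blast
  next
    case 2
    then obtain p p' q q' r r' where pqr: "P Z1 = {p, p'}" "P Z2 = {q, q'}" "P Z3 = {r, r'}"
        and ne: "p \<noteq> p'" "q \<noteq> q'" "r \<noteq> r'"
      using sizes by (metis card_2_iff)
    have "distinct [p, p', q, q', r, r']" using disj(1-3) ne unfolding pqr by auto
    from T2[OF this] show False
      using petal_parity petal_parity2 petal_parity3
      unfolding pqr odd_card_pair[OF ne(1)] odd_card_pair[OF ne(2)] odd_card_pair[OF ne(3)] by blast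
  qed
qed

lemma card_parity_level:
  fixes A :: "bool option \<Rightarrow> 'v::ab_group_add set" and T :: "'j::finite \<Rightarrow> 'j \<Rightarrow> bool"
  assumes A: "extendable A" and fin: "\<And>l. finite (A l)" and torsion: "\<And>x :: 'v. x + x + x = 0"
    and c: "\<And>b. card (A (Some b)) = c"
    and adm: "admissible {Z. card Z = t} (parity_word T)"
  shows "card (\<Union>Z\<in>{Z. card Z = t}. word_prod A (parity_word T Z)) =
    (CARD('j) choose t) * (card (A None) ^ t * c ^ (CARD('j) - t))"
proof -
  have "(\<Prod>i\<in>UNIV. card (A (parity_word T Z i))) = card (A None) ^ t * c ^ (CARD('j) - t)"
    if "card Z = t" for Z
  proof -
    have "(\<Prod>i\<in>UNIV. card (A (parity_word T Z i))) =
        (\<Prod>i\<in>Z. card (A (parity_word T Z i))) * (\<Prod>i\<in>-Z. card (A (parity_word T Z i)))"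
      by (subst prod.union_disjoint[symmetric]) (auto simp: Un_commute)
    also have "(\<Prod>i\<in>Z. card (A (parity_word T Z i))) = card (A None) ^ t"
      using that by (simp add: parity_word_def)
    also have "(\<Prod>i\<in>-Z. card (A (parity_word T Z i))) = c ^ (CARD('j) - t)"
      using that by (simp add: parity_word_def c Compl_eq_Diff_UNIV card_Diff_subset)
    finally show ?thesis .
  qed
  moreover have "card {Z :: 'j set. card Z = t} = CARD('j) choose t"
    using n_subsets[of "UNIV :: 'j set" t] by simp
  ultimately show ?thesis
    by (simp add: card_Union_word_prod[OF A fin adm _ torsion])
qed

section \<open>An admissible set of words of length 9\<close>

text \<open>Found by computer search. Row \<open>p\<close> lists the \<open>q\<close> with \<open>T9 p q\<close>; it is \<open>{p + 2, p + 4}\<close> modulo 8 for even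
  \<open>p < 8\<close> and \<open>{p + 4, p + 6}\<close> modulo 8 for odd \<open>p\<close>.\<close>

definition rows9 :: "nat list list" where
  "rows9 = [[2, 4], [5, 7], [4, 6], [1, 7], [0, 6], [1, 3], [0, 2], [3, 5], [0, 2, 4, 6]]"

definition T9 :: "nat \<Rightarrow> nat \<Rightarrow> bool" where
  "T9 p q \<longleftrightarrow> q \<in> set (rows9 ! p)"

lemma T9_triples:
  "\<forall>x\<in>set [0..<9]. \<forall>y\<in>set [0..<9]. \<forall>z\<in>set [0..<9]. distinct [x, y, z] \<longrightarrow>
    \<not> (T9 x y = T9 x z \<and> T9 y x = T9 y z \<and> T9 z x = T9 z y)"
  by code_simp

text \<open>Only increasing pairs are enumerated; the condition is symmetric within each pair, which
  saves a factor of 8 in the search.\<close>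

lemma T9_matchings:
  "\<forall>p\<in>set [0..<9]. \<forall>p'\<in>set [Suc p..<9].
   \<forall>q\<in>set (filter (\<lambda>q. q \<noteq> p \<and> q \<noteq> p') [0..<9]). \<forall>q'\<in>set (filter (\<lambda>q'. q' \<noteq> p \<and> q' \<noteq> p') [Suc q..<9]).
   \<forall>r\<in>set (filter (\<lambda>r. r \<noteq> p \<and> r \<noteq> p' \<and> r \<noteq> q \<and> r \<noteq> q') [0..<9]).
   \<forall>r'\<in>set (filter (\<lambda>r'. r' \<noteq> p \<and> r' \<noteq> p' \<and> r' \<noteq> q \<and> r' \<noteq> q') [Suc r..<9]).
     \<not> ((T9 p q \<noteq> T9 p q') = (T9 p r \<noteq> T9 p r') \<and> (T9 p' q \<noteq> T9 p' q') = (T9 p' r \<noteq> T9 p' r') \<and>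
        (T9 q p \<noteq> T9 q p') = (T9 q r \<noteq> T9 q r') \<and> (T9 q' p \<noteq> T9 q' p') = (T9 q' r \<noteq> T9 q' r') \<and>
        (T9 r p \<noteq> T9 r p') = (T9 r q \<noteq> T9 r q') \<and> (T9 r' p \<noteq> T9 r' p') = (T9 r' q \<noteq> T9 r' q'))"
  by code_simp

lemma T9_matching:
  assumes d: "distinct [p, p', q, q', r, r']" and lt: "p < 9" "p' < 9" "q < 9" "q' < 9" "r < 9" "r' < 9"
  shows "\<not> ((\<forall>x\<in>{p, p'}. (T9 x q \<noteq> T9 x q') = (T9 x r \<noteq> T9 x r')) \<and>
      (\<forall>x\<in>{q, q'}. (T9 x p \<noteq> T9 x p') = (T9 x r \<noteq> T9 x r')) \<and>
      (\<forall>x\<in>{r, r'}. (T9 x p \<noteq> T9 x p') = (T9 x q \<noteq> T9 x q')))" (is "\<not> ?bad p p' q q' r r'")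
proof -
  have wlog: "\<not> ?bad p p' q q' r r'"
    if "distinct [p, p', q, q', r, r']" "p < 9" "p' < 9" "q < 9" "q' < 9" "r < 9" "r' < 9" "p < p'" "q < q'" "r < r'"
    for p p' q q' r r'
  proof -
    have "p \<in> set [0..<9]" "p' \<in> set [Suc p..<9]" "q \<in> set (filter (\<lambda>q. q \<noteq> p \<and> q \<noteq> p') [0..<9])"
      "q' \<in> set (filter (\<lambda>q'. q' \<noteq> p \<and> q' \<noteq> p') [Suc q..<9])"
      "r \<in> set (filter (\<lambda>r. r \<noteq> p \<and> r \<noteq> p' \<and> r \<noteq> q \<and> r \<noteq> q') [0..<9])"
      "r' \<in> set (filter (\<lambda>r'. r' \<noteq> p \<and> r' \<noteq> p' \<and> r' \<noteq> q \<and> r' \<noteq> q') [Suc r..<9])"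
      using that by auto
    from T9_matchings[THEN bspec, THEN bspec, THEN bspec, THEN bspec, THEN bspec, THEN bspec, OF this]
    show ?thesis by simp
  qed
  define D where "D x y z \<longleftrightarrow> T9 x y \<noteq> T9 x z" for x y z
  have D_commute: "D x y z \<longleftrightarrow> D x z y" for x y z by (auto simp: D_def)
  have swap: "?bad p p' q q' r r' = ?bad p' p q q' r r'" "?bad p p' q q' r r' = ?bad p p' q' q r r'"
    "?bad p p' q q' r r' = ?bad p p' q q' r' r" for p p' q q' r r'
    unfolding D_def[symmetric] by (simp_all only: insert_commute D_commute)
  define a b where "a = min p p'" and "b = max p p'"
  define c e where "c = min q q'" and "e = max q q'"
  define f g where "f = min r r'" and "g = max r r'"
  have "a < b" "c < e" "f < g"
    using d by (auto simp: a_def b_def c_def e_def f_def g_def min_def max_def less_le)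
  then have not_bad: "\<not> ?bad a b c e f g"
    using d lt by (intro wlog) (auto simp: a_def b_def c_def e_def f_def g_def min_def max_def)
  have eq: "?bad a b c e f g = ?bad p p' q q' r r'"
  proof -
    have 1: "(a = p \<and> b = p') \<or> (a = p' \<and> b = p)" by (auto simp: a_def b_def min_def max_def)
    have 2: "(c = q \<and> e = q') \<or> (c = q' \<and> e = q)" by (auto simp: c_def e_def min_def max_def)
    have 3: "(f = r \<and> g = r') \<or> (f = r' \<and> g = r)" by (auto simp: f_def g_def min_def max_def)
    have "?bad a b c e f g = ?bad p p' c e f g" using 1 swap(1) by blast
    also have "\<dots> = ?bad p p' q q' f g" using 2 swap(2) by blast
    also have "\<dots> = ?bad p p' q q' r r'" using 3 swap(3) by blast
    finally show ?thesis .
  qed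
  show ?thesis using not_bad unfolding eq .
qed

lemma admissible_parity_T9:
  fixes e :: "'j::finite \<Rightarrow> nat"
  assumes e: "bij_betw e UNIV {0..<9}"
  shows "admissible {Z :: 'j set. card Z = 4} (parity_word (\<lambda>p q. T9 (e p) (e q)))"
proof (rule admissible_parity_word)
  show "CARD('j) = 9" using bij_betw_same_card[OF e] by simp
  have inj: "e x = e y \<longleftrightarrow> x = y" for x y using bij_betw_imp_inj_on[OF e] by (auto dest: injD)
  have lt: "e x < 9" for x using bij_betw_apply[OF e, of x] by simp
  show "\<not> (T9 (e x) (e y) = T9 (e x) (e z) \<and> T9 (e y) (e x) = T9 (e y) (e z) \<and> T9 (e z) (e x) = T9 (e z) (e y))"
    if "distinct [x, y, z]" for x y z
  proof -
    have "e x \<in> set [0..<9]" "e y \<in> set [0..<9]" "e z \<in> set [0..<9]" using lt by auto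
    from T9_triples[THEN bspec, THEN bspec, THEN bspec, OF this] that show ?thesis by (simp add: inj)
  qed
  show "\<not> ((\<forall>x\<in>{p, p'}. (T9 (e x) (e q) \<noteq> T9 (e x) (e q')) = (T9 (e x) (e r) \<noteq> T9 (e x) (e r'))) \<and>
      (\<forall>x\<in>{q, q'}. (T9 (e x) (e p) \<noteq> T9 (e x) (e p')) = (T9 (e x) (e r) \<noteq> T9 (e x) (e r'))) \<and>
      (\<forall>x\<in>{r, r'}. (T9 (e x) (e p) \<noteq> T9 (e x) (e p')) = (T9 (e x) (e q) \<noteq> T9 (e x) (e q'))))"
    if "distinct [p, p', q, q', r, r']" for p p' q q' r r'
    using T9_matching[of "e p" "e p'" "e q" "e q'" "e r" "e r'"] that lt by (simp add: inj)
qed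

section \<open>The cap of size 112 in dimension 6\<close>

definition support :: "('i \<Rightarrow> 3) \<Rightarrow> 'i set" where
  "support x = {i. x i \<noteq> 0}"

lemma mem_support_iff: "i \<in> support x \<longleftrightarrow> x i \<noteq> 0"
  by (simp add: support_def)

lemma sum_zero_support:
  fixes a b c :: 3
  assumes "a + b + c = 0"
  shows "a \<noteq> 0 \<Longrightarrow> b \<noteq> 0 \<or> c \<noteq> 0" "b \<noteq> 0 \<Longrightarrow> a \<noteq> 0 \<or> c \<noteq> 0" "c \<noteq> 0 \<Longrightarrow> a \<noteq> 0 \<or> b \<noteq> 0"
    "a \<noteq> 0 \<Longrightarrow> b \<noteq> 0 \<Longrightarrow> c \<noteq> 0 \<Longrightarrow> a = b \<and> b = c" "c = 0 \<Longrightarrow> a = - b"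
  using assms by (cases a rule: three_cases; cases b rule: three_cases; cases c rule: three_cases; simp)+

lemma prod_square_eq_1:
  assumes "\<And>i. i \<in> I \<Longrightarrow> x i \<noteq> (0::3)"
  shows "prod x I * prod x I = 1"
  using assms by (simp add: square_eq_one_3 flip: prod.distrib)

lemma prod_eq_neg_on:
  fixes x y :: "'i::finite \<Rightarrow> 3"
  assumes "\<And>i. i \<in> S \<Longrightarrow> x i = y i" "\<And>i. i \<notin> S \<Longrightarrow> x i = - y i" "odd (card (- S))"
  shows "prod x UNIV = - prod y UNIV"
proof -
  have split: "prod z UNIV = prod z S * prod z (- S)" for z :: "'i \<Rightarrow> 3"
    by (subst prod.union_disjoint[symmetric]) (auto simp: Un_commute)
  have "prod x S = prod y S" using assms(1) by (intro prod.cong) auto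
  moreover have "prod x (- S) = prod (\<lambda>i. - 1 * y i) (- S)" using assms(2) by (intro prod.cong) auto
  moreover have "\<dots> = - prod y (- S)" using assms(3) by (simp only: prod.distrib prod_constant) simp
  ultimately show ?thesis by (simp add: split)
qed

text \<open>If \<open>\<B> False\<close> and \<open>\<B> True\<close> are the blocks of two complementary 2-(6,3,2) designs, then the vectors with
  support in a block together with the 32 vectors without zeros and with an even number of minus signs
  form a maximum cap of size 112 in \<open>\<int>\<^sub>3\<^sup>6\<close>.\<close>

definition base_cap :: "(bool \<Rightarrow> 6 set set) \<Rightarrow> bool option \<Rightarrow> (6 \<Rightarrow> 3) set" where
  "base_cap \<B> l = (case l of None \<Rightarrow> {x. card (support x) = 1}
     | Some b \<Rightarrow> {x. support x \<in> \<B> b} \<union> {x. support x = UNIV \<and> prod x UNIV = 1})"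

lemma card_support_eq: "card {x :: 'i::finite \<Rightarrow> 3. support x = T} = 2 ^ card T"
proof -
  have "{x :: 'i \<Rightarrow> 3. support x = T} = PiE UNIV (\<lambda>i. if i \<in> T then {1, 2} else {0})"
  proof (intro equalityI subsetI)
    fix x :: "'i \<Rightarrow> 3" assume "x \<in> {x. support x = T}"
    then have supp: "x i \<noteq> 0 \<longleftrightarrow> i \<in> T" for i by (auto simp: support_def)
    have "x i \<in> (if i \<in> T then {1, 2} else {0})" for i
      using supp[of i] by (cases "x i" rule: three_cases) simp_all
    then show "x \<in> PiE UNIV (\<lambda>i. if i \<in> T then {1, 2} else {0})" by (intro PiE_I) simp_all
  next
    fix x :: "'i \<Rightarrow> 3" assume x: "x \<in> PiE UNIV (\<lambda>i. if i \<in> T then {1, 2} else {0})"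
    have mem: "x i \<in> (if i \<in> T then {1, 2} else {0})" for i using PiE_mem[OF x UNIV_I] .
    have "x i \<noteq> 0 \<longleftrightarrow> i \<in> T" for i using mem[of i] by (cases "i \<in> T") auto
    then show "x \<in> {x. support x = T}" by (auto simp: support_def)
  qed
  moreover have "card (PiE UNIV (\<lambda>i. if i \<in> T then {1, 2 :: 3} else {0})) = (\<Prod>i\<in>UNIV. if i \<in> T then 2 else 1)"
    by (subst card_PiE) (auto intro!: prod.cong)
  moreover have "\<dots> = (2::nat) ^ card T" by (simp add: prod.If_cases)
  ultimately show ?thesis by simp
qed

text \<open>Flipping the sign of one coordinate is a bijection between product 1 and product
  -1.\<close>

lemma card_full_support_prod_1: "2 * card {x :: 'i::finite \<Rightarrow> 3. support x = UNIV \<and> prod x UNIV = 1} = 2 ^ CARD('i)"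
proof -
  let ?E = "{x :: 'i \<Rightarrow> 3. support x = UNIV \<and> prod x UNIV = 1}"
  let ?O = "{x :: 'i \<Rightarrow> 3. support x = UNIV \<and> prod x UNIV = - 1}"
  obtain k :: 'i where True by simp
  define flip where "flip x = (x :: 'i \<Rightarrow> 3)(k := - x k)" for x
  have flip_flip: "flip (flip x) = x" for x by (simp add: flip_def)
  have flip_support: "support (flip x) = support x" for x by (auto simp: flip_def support_def)
  have flip_prod: "prod (flip x) UNIV = - prod x UNIV" for x
    by (rule prod_eq_neg_on[where S = "- {k}"]) (auto simp: flip_def)
  have "bij_betw flip ?E ?O"
    by (rule bij_betw_byWitness[where f' = flip]) (auto simp: flip_flip flip_support flip_prod)
  then have "card ?E = card ?O" by (rule bij_betw_same_card)
  moreover have "?E \<inter> ?O = {}" by auto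
  moreover have "?E \<union> ?O = {x. support x = UNIV}"
  proof -
    have "prod x UNIV = 1 \<or> prod x UNIV = - 1" if "support x = UNIV" for x :: "'i \<Rightarrow> 3"
    proof -
      have "prod x UNIV * prod x UNIV = 1" using that by (intro prod_square_eq_1) (auto simp: support_def)
      then show ?thesis by (cases "prod x UNIV" rule: three_cases) auto
    qed
    then show ?thesis by auto
  qed
  ultimately have "2 * card ?E = card {x :: 'i \<Rightarrow> 3. support x = UNIV}"
    by (metis (no_types, lifting) card_Un_disjoint finite mult_2)
  then show ?thesis by (simp add: card_support_eq)
qed

text \<open>\<open>odd_point\<close> provides a point lying in exactly one of the three blocks: the
  chained equivalence means an odd number of memberships, and the last conjunct excludes
  three.\<close>

locale block_designs =
  fixes \<B> :: "bool \<Rightarrow> 6 set set"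
  assumes card_\<B>: "card (\<B> b) = 10"
    and card_block: "T \<in> \<B> b \<Longrightarrow> card T = 3"
    and not_complementary: "S \<in> \<B> b \<Longrightarrow> T \<in> \<B> b \<Longrightarrow> \<exists>i. i \<in> S \<longleftrightarrow> i \<in> T"
    and odd_point: "R \<in> \<B> b \<Longrightarrow> S \<in> \<B> b \<Longrightarrow> T \<in> \<B> b \<Longrightarrow> \<not> (R = S \<and> S = T) \<Longrightarrow>
       \<exists>i. (i \<in> R \<longleftrightarrow> i \<in> S \<longleftrightarrow> i \<in> T) \<and> \<not> (i \<in> R \<and> i \<in> S)"
    and \<B>_disjoint: "\<B> False \<inter> \<B> True = {}"
begin

lemma card_base_cap_Some: "card (base_cap \<B> (Some b)) = 112"
proof -
  have "{x. support x \<in> \<B> b} = (\<Union>T\<in>\<B> b. {x. support x = T})" by auto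
  then have "card {x. support x \<in> \<B> b} = (\<Sum>T\<in>\<B> b. card {x :: 6 \<Rightarrow> 3. support x = T})"
    by (simp only:) (rule card_UN_disjoint; auto)
  also have "\<dots> = 80" by (simp add: card_support_eq card_block card_\<B>)
  finally have 1: "card {x. support x \<in> \<B> b} = 80" .
  have 2: "card {x :: 6 \<Rightarrow> 3. support x = UNIV \<and> prod x UNIV = 1} = 32"
    using card_full_support_prod_1[where 'i = 6] by simp
  have "UNIV \<notin> \<B> b" using card_block[of UNIV b] by auto
  then show ?thesis unfolding base_cap_def
    by (simp, subst card_Un_disjoint) (auto simp: 1 2)
qed

lemma card_base_cap_None: "card (base_cap \<B> None) = 12"
proof -
  have "base_cap \<B> None = (\<Union>T\<in>{T. card T = 1}. {x. support x = T})" by (auto simp: base_cap_def)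
  then have "card (base_cap \<B> None) = (\<Sum>T\<in>{T. card T = 1}. card {x :: 6 \<Rightarrow> 3. support x = T})"
    by (simp only:) (rule card_UN_disjoint; auto)
  also have "\<dots> = 2 * card {T :: 6 set. card T = 1}" by (simp add: card_support_eq)
  also have "card {T :: 6 set. card T = 1} = 6"
    using n_subsets[of "UNIV :: 6 set" 1] by simp
  finally show ?thesis by simp
qed

lemma base_cap_Some_cases:
  assumes "x \<in> base_cap \<B> (Some b)"
  obtains "support x \<in> \<B> b" "card (support x) = 3" | "support x = UNIV" "prod x UNIV = 1" "card (support x) = 6"
  using assms card_block by (auto simp: base_cap_def)

lemma is_cap_base_cap_None: "is_cap (base_cap \<B> None)"
  unfolding is_cap_def
proof (intro ballI impI)
  fix x y z assume "x \<in> base_cap \<B> None" "y \<in> base_cap \<B> None" "z \<in> base_cap \<B> None" and "x + y + z = 0"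
  then obtain i j k where ijk: "support x = {i}" "support y = {j}" "support z = {k}"
    and sum0: "\<And>i. x i + y i + z i = 0"
    by (auto simp: base_cap_def card_1_singleton_iff) (metis plus_fun_apply zero_fun_apply)
  have x: "x m \<noteq> 0 \<longleftrightarrow> m = i" and y: "y m \<noteq> 0 \<longleftrightarrow> m = j" and z: "z m \<noteq> 0 \<longleftrightarrow> m = k" for m
    using ijk by (simp_all flip: mem_support_iff)
  have "i = j \<or> i = k" "j = i \<or> j = k" "k = i \<or> k = j"
    using sum_zero_support(1)[OF sum0[of i]] sum_zero_support(2)[OF sum0[of j]] sum_zero_support(3)[OF sum0[of k]] x y z
    by blast+
  then have eq: "j = i" "k = i" by auto
  have "x m = y m \<and> y m = z m" for m
    using sum_zero_support(4)[OF sum0[of m]] x[of m] y[of m] z[of m] eq by (cases "m = i") auto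
  then show "x = y \<and> y = z" by auto
qed

text \<open>\<open>x\<close> and \<open>y\<close> agree on the support of \<open>z\<close> and are
  opposite off it; an odd number of sign changes contradicts the equal products.\<close>

lemma no_two_full:
  fixes x :: "'i::finite \<Rightarrow> 3"
  assumes sum0: "\<And>i. x i + y i + z i = 0" and full: "support x = UNIV" "support y = UNIV"
    and prods: "prod x UNIV = 1" "prod y UNIV = 1" and z: "odd (card (- support z))"
  shows False
proof -
  have nz: "x i \<noteq> 0" "y i \<noteq> 0" for i using full by (auto simp flip: mem_support_iff)
  have "x i = y i" if "i \<in> support z" for i
    using sum_zero_support(4)[OF sum0[of i]] nz that by (simp add: mem_support_iff)
  moreover have "x i = - y i" if "i \<notin> support z" for i
    using sum_zero_support(5)[OF sum0[of i]] that by (simp add: mem_support_iff)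
  ultimately have "prod x UNIV = - prod y UNIV" using z by (intro prod_eq_neg_on[of "support z"]) auto
  with prods show False by simp
qed

text \<open>The supports of \<open>y\<close> and \<open>z\<close> would have to cover all six
  points, which makes them complementary blocks.\<close>

lemma no_one_full:
  assumes sum0: "\<And>i. x i + y i + z i = 0" and x: "support x = UNIV"
    and yz: "support y \<in> \<B> b" "support z \<in> \<B> b"
  shows False
proof -
  have "x i \<noteq> 0" for i using x by (auto simp flip: mem_support_iff)
  then have "i \<in> support y \<or> i \<in> support z" for i
    using sum_zero_support(1)[OF sum0[of i]] by (simp add: mem_support_iff)
  then have sub: "- support y \<subseteq> support z" by auto
  have "card (- support y) = card (support z)"
    using yz by (simp add: card_block Compl_eq_Diff_UNIV card_Diff_subset)
  with sub have "- support y = support z" by (intro card_subset_eq) auto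
  with not_complementary[OF yz] show False by auto
qed

text \<open>Cases by the number of vectors without zeros: none is settled by
  \<open>odd_point\<close>, one by \<open>no_one_full\<close>, two by \<open>no_two_full\<close>;
  with three the supports agree, so nonzero entries are equal.\<close>

lemma is_cap_base_cap_Some: "is_cap (base_cap \<B> (Some b))"
  unfolding is_cap_def
proof (intro ballI impI)
  fix x y z assume x: "x \<in> base_cap \<B> (Some b)" and y: "y \<in> base_cap \<B> (Some b)" and z: "z \<in> base_cap \<B> (Some b)"
    and "x + y + z = 0"
  then have sum0: "x i + y i + z i = 0" for i by (metis plus_fun_apply zero_fun_apply)
  then have perms: "y i + z i + x i = 0" "z i + x i + y i = 0" for i by (simp_all add: ac_simps)
  have odd: "odd (card (- T))" if "card T = 3" for T :: "6 set"
    using that by (simp add: Compl_eq_Diff_UNIV card_Diff_subset)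
  have same: "x = y \<and> y = z" if "support x = support y" "support y = support z"
  proof -
    have "x i = y i \<and> y i = z i" for i
    proof (cases "x i = 0")
      case True
      then have "y i = 0" "z i = 0" using that by (simp_all add: set_eq_iff mem_support_iff)
      with True show ?thesis by simp
    next
      case False
      then have "y i \<noteq> 0" "z i \<noteq> 0" using that by (simp_all add: set_eq_iff mem_support_iff)
      with False show ?thesis using sum_zero_support(4)[OF sum0] by blast
    qed
    then show ?thesis by auto
  qed
  show "x = y \<and> y = z"
    using x
  proof (cases rule: base_cap_Some_cases)
    case x: 1
    show ?thesis using y
    proof (cases rule: base_cap_Some_cases)
      case y: 1
      show ?thesis using z
      proof (cases rule: base_cap_Some_cases)
        case z: 1
        have "support x = support y \<and> support y = support z"
        proof (rule ccontr)
          assume "\<not> ?thesis"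
          from odd_point[OF x(1) y(1) z(1) this] obtain i
            where "(i \<in> support x \<longleftrightarrow> i \<in> support y \<longleftrightarrow> i \<in> support z) \<and> \<not> (i \<in> support x \<and> i \<in> support y)" ..
          then show False using sum_zero_support(1-3)[OF sum0[of i]] by (auto simp: mem_support_iff)
        qed
        then show ?thesis using same by blast
      next
        case 2
        with no_one_full[where x = z and y = x and z = y, OF perms(2)] x y show ?thesis by blast
      qed
    next
      case y: 2
      show ?thesis using z
      proof (cases rule: base_cap_Some_cases)
        case 1
        with no_one_full[where x = y and y = z and z = x, OF perms(1)] x y show ?thesis by blast
      next
        case 2
        with no_two_full[where x = y and y = z and z = x, OF perms(1) y(1) 2(1) y(2) 2(2) odd] x show ?thesis by blast
      qed
    qed
  next
    case x: 2
    show ?thesis using y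
    proof (cases rule: base_cap_Some_cases)
      case y: 1
      show ?thesis using z
      proof (cases rule: base_cap_Some_cases)
        case 1
        with no_one_full[where x = x and y = y and z = z, OF sum0] x y show ?thesis by blast
      next
        case 2
        with no_two_full[where x = z and y = x and z = y, OF perms(2) 2(1) x(1) 2(2) x(2) odd] y show ?thesis by blast
      qed
    next
      case y: 2
      show ?thesis using z
      proof (cases rule: base_cap_Some_cases)
        case 1
        with no_two_full[where x = x and y = y and z = z, OF sum0 x(1) y(1) x(2) y(2) odd] show ?thesis by blast
      next
        case 2
        then show ?thesis using same x y by simp
      qed
    qed
  qed
qed

text \<open>Two vectors of weight 1 cannot cancel one of weight at least 3. For 012, one vector of
  weight 1 changes the support size by at most 1, so the other two both have weight 3, with equal
  supports against disjointness of the designs, or both have weight 6, against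
  \<open>no_two_full\<close>.\<close>

lemma extendable_base_cap: "extendable (base_cap \<B>)"
  unfolding extendable_def
proof (intro conjI allI)
  show "is_cap (base_cap \<B> l)" for l
    using is_cap_base_cap_None is_cap_base_cap_Some by (cases l) auto
  show "sum_avoiding (base_cap \<B> None) (base_cap \<B> None) (base_cap \<B> (Some b))" for b
    unfolding sum_avoiding_def
  proof (intro ballI notI)
    fix x y z assume x: "x \<in> base_cap \<B> None" and y: "y \<in> base_cap \<B> None" and z: "z \<in> base_cap \<B> (Some b)"
      and "x + y + z = 0"
    then have sum0: "x i + y i + z i = 0" for i by (metis plus_fun_apply zero_fun_apply)
    have "support z \<subseteq> support x \<union> support y"
      using sum_zero_support(3)[OF sum0] by (auto simp: mem_support_iff)
    then have "card (support z) \<le> card (support x \<union> support y)" by (intro card_mono) auto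
    also have "\<dots> \<le> card (support x) + card (support y)" by (rule card_Un_le)
    also have "\<dots> = 2" using x y by (simp add: base_cap_def)
    finally show False using z by (auto elim!: base_cap_Some_cases)
  qed
  show "sum_avoiding (base_cap \<B> None) (base_cap \<B> (Some False)) (base_cap \<B> (Some True))"
    unfolding sum_avoiding_def
  proof (intro ballI notI)
    fix x y z assume x: "x \<in> base_cap \<B> None" and y: "y \<in> base_cap \<B> (Some False)"
      and z: "z \<in> base_cap \<B> (Some True)" and "x + y + z = 0"
    then have sum0: "x i + y i + z i = 0" for i by (metis plus_fun_apply zero_fun_apply)
    then have perm: "y i + z i + x i = 0" for i by (simp add: ac_simps)
    have cx: "card (support x) = 1" using x by (simp add: base_cap_def)
    have yz: "support y \<subseteq> support z \<union> support x" "support z \<subseteq> support y \<union> support x"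
      using sum_zero_support(2,3)[OF sum0] by (auto simp: mem_support_iff)
    have "card (support z \<union> support x) \<le> card (support z) + 1" "card (support y \<union> support x) \<le> card (support y) + 1"
      using card_Un_le[of "support z" "support x"] card_Un_le[of "support y" "support x"] cx by simp_all
    then have c: "card (support y) \<le> card (support z) + 1" "card (support z) \<le> card (support y) + 1"
      using card_mono[OF _ yz(1)] card_mono[OF _ yz(2)] by simp_all
    show False using y
    proof (cases rule: base_cap_Some_cases)
      case y: 1
      show False using z
      proof (cases rule: base_cap_Some_cases)
        case z: 1
        obtain i where i: "support x = {i}" using cx by (auto simp: card_1_singleton_iff)
        have "support y = support z"
        proof (cases "i \<in> support z")
          case True
          then show ?thesis using yz(1) i y(2) z(2) by (intro card_subset_eq) auto
        next
          case False
          then show ?thesis using yz(2) i y(2) z(2) by (intro card_subset_eq[symmetric]) auto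
        qed
        then show False using y(1) z(1) \<B>_disjoint by auto
      qed (use c y in simp)
    next
      case y: 2
      show False using z
      proof (cases rule: base_cap_Some_cases)
        case z: 2
        have "odd (card (- support x))"
          using cx by (simp add: Compl_eq_Diff_UNIV card_Diff_subset)
        from no_two_full[where x = y and y = z and z = x, OF perm y(1) z(1) y(2) z(2) this] show False .
      qed (use c y in simp)
    qed
  qed
qed

end

section \<open>The two designs, given explicitly\<close>

text \<open>Each list consists of two orbits of the rotation of 0, ..., 4 modulo 5 that fixes 5;
  together they are all 20 triples.\<close>

definition block_list :: "bool \<Rightarrow> nat list list" where
  "block_list b = (if b
    then [[0,1,5],[1,2,5],[2,3,5],[3,4,5],[0,4,5],[0,1,3],[1,2,4],[0,2,3],[1,3,4],[0,2,4]]
    else [[0,2,5],[1,3,5],[2,4,5],[0,3,5],[1,4,5],[0,1,2],[1,2,3],[2,3,4],[0,3,4],[0,1,4]])"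

lemma block_list_triples:
  "\<forall>r\<in>set (block_list b). \<forall>s\<in>set (block_list b). \<forall>t\<in>set (block_list b). \<not> (r = s \<and> s = t) \<longrightarrow>
     (\<exists>i\<in>set [0..<6]. (i \<in> set r \<longleftrightarrow> i \<in> set s \<longleftrightarrow> i \<in> set t) \<and> \<not> (i \<in> set r \<and> i \<in> set s))"
  by (cases b; simp only:; code_simp)

lemma block_list_complement:
  "\<forall>s\<in>set (block_list b). \<forall>t\<in>set (block_list b). \<exists>i\<in>set [0..<6]. i \<in> set s \<longleftrightarrow> i \<in> set t"
  by (cases b; simp only:; code_simp)

lemma block_list_disjoint:
  "\<forall>s\<in>set (block_list False). \<forall>t\<in>set (block_list True). \<exists>i\<in>set [0..<6]. i \<in> set s \<longleftrightarrow> i \<notin> set t"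
  by code_simp

lemma block_list_shape:
  "distinct (block_list b)" "length (block_list b) = 10"
  "\<forall>s\<in>set (block_list b). distinct s \<and> length s = 3 \<and> set s \<subseteq> {0..<6}"
  by (cases b; simp add: block_list_def)+

lemma block_designs_exist: "\<exists>\<B>. block_designs \<B>"
proof -
  have "card (UNIV :: 6 set) = 6" by simp
  then obtain e :: "6 \<Rightarrow> nat" where e: "bij_betw e UNIV {0..<6}"
    using ex_bij_betw_finite_nat[of "UNIV :: 6 set"] by auto
  have surj: "\<exists>i. k = e i" if "k \<in> set [0..<6]" for k
    using that bij_betw_imp_surj_on[OF e] by auto
  define v where "v s = {i. e i \<in> set s}" for s
  have v: "i \<in> v s \<longleftrightarrow> e i \<in> set s" for i s by (simp add: v_def)
  have inj: "inj_on v (set (block_list b))" for b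
  proof (rule inj_onI)
    fix s t assume st: "s \<in> set (block_list b)" "t \<in> set (block_list b)" "v s = v t"
    show "s = t"
    proof (rule ccontr)
      assume "s \<noteq> t"
      \<comment> \<open>The triple with \<open>s\<close> repeated yields a point of \<open>t\<close>
        outside \<open>s\<close>.\<close>
      then obtain k where k: "k \<in> set [0..<6]"
        "(k \<in> set s \<longleftrightarrow> k \<in> set s \<longleftrightarrow> k \<in> set t) \<and> \<not> (k \<in> set s \<and> k \<in> set s)"
        using block_list_triples[THEN bspec, THEN bspec, THEN bspec, OF st(1) st(1) st(2)] by blast
      from surj[OF k(1)] obtain i where "k = e i" ..
      with k(2) show False using st(3) v by blast
    qed
  qed
  have "block_designs (\<lambda>b. v ` set (block_list b))"
  proof
    show "card (v ` set (block_list b)) = 10" for b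
      using inj block_list_shape[of b] by (simp add: card_image distinct_card)
    show "card T = 3" if T: "T \<in> v ` set (block_list b)" for b T
    proof -
      from T obtain s where s: "s \<in> set (block_list b)" "T = v s" by blast
      have "card (e -` set s) = card (set s)"
        using bij_betw_imp_inj_on[OF e] bij_betw_imp_surj_on[OF e] block_list_shape(3)[of b] s(1)
        by (intro card_vimage_inj) auto
      moreover have "v s = e -` set s" by (auto simp: v_def)
      moreover have "card (set s) = 3" using block_list_shape(3)[of b] s(1) by (auto simp: distinct_card)
      ultimately show ?thesis by (simp add: s(2))
    qed
    show "\<exists>i. i \<in> S \<longleftrightarrow> i \<in> T" if ST: "S \<in> v ` set (block_list b)" "T \<in> v ` set (block_list b)" for b S T
    proof -
      from ST obtain s t where st: "s \<in> set (block_list b)" "t \<in> set (block_list b)" "S = v s" "T = v t"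
        by blast
      obtain k where k: "k \<in> set [0..<6]" "k \<in> set s \<longleftrightarrow> k \<in> set t"
        using block_list_complement[THEN bspec, THEN bspec, OF st(1,2)] by blast
      from surj[OF k(1)] obtain i where "k = e i" ..
      with k(2) show ?thesis unfolding st(3,4) v by blast
    qed
    show "\<exists>i. (i \<in> R \<longleftrightarrow> i \<in> S \<longleftrightarrow> i \<in> T) \<and> \<not> (i \<in> R \<and> i \<in> S)"
      if RST: "R \<in> v ` set (block_list b)" "S \<in> v ` set (block_list b)" "T \<in> v ` set (block_list b)" "\<not> (R = S \<and> S = T)" for b R S T
    proof -
      from RST(1-3) obtain r s t where rst: "r \<in> set (block_list b)" "s \<in> set (block_list b)"
        "t \<in> set (block_list b)" "R = v r" "S = v s" "T = v t" by blast
      have "\<not> (r = s \<and> s = t)" using RST(4) rst(4-6) by auto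
      then obtain k where k: "k \<in> set [0..<6]"
        "(k \<in> set r \<longleftrightarrow> k \<in> set s \<longleftrightarrow> k \<in> set t) \<and> \<not> (k \<in> set r \<and> k \<in> set s)"
        using block_list_triples[THEN bspec, THEN bspec, THEN bspec, OF rst(1-3)] by blast
      from surj[OF k(1)] obtain i where "k = e i" ..
      with k(2) show ?thesis unfolding rst(4-6) v by blast
    qed
    show "v ` set (block_list False) \<inter> v ` set (block_list True) = {}"
    proof (rule ccontr)
      assume "v ` set (block_list False) \<inter> v ` set (block_list True) \<noteq> {}"
      then obtain s t where st: "s \<in> set (block_list False)" "t \<in> set (block_list True)" "v s = v t" by blast
      obtain k where k: "k \<in> set [0..<6]" "k \<in> set s \<longleftrightarrow> k \<notin> set t"
        using block_list_disjoint[THEN bspec, THEN bspec, OF st(1,2)] by blast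
      from surj[OF k(1)] obtain i where "k = e i" ..
      with k(2) show False using st(3) v by blast
    qed
  qed
  then show ?thesis by (intro exI)
qed

section \<open>A large cap in dimension 432\<close>

text \<open>The maps \<open>c l\<close> are additive coordinates on \<open>'v\<close> with trivial
  common kernel. The first \<open>k * (n div k)\<close> coordinates carry a power of
  \<open>D\<close>, the remaining ones are zero.\<close>

lemma cap_power_le_r_ap_3:
  fixes D :: "'v::ab_group_add set" and c :: "nat \<Rightarrow> 'v \<Rightarrow> 3"
  assumes D: "finite D" "is_cap D" and k: "k > 0"
    and add: "\<And>l x y. c l (x + y) = c l x + c l y"
    and faithful: "\<And>x. (\<And>l. l < k \<Longrightarrow> c l x = 0) \<Longrightarrow> x = 0"
  shows "card D ^ (n div k) \<le> r_ap 3 (Zmn 3 n)"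
proof -
  define q where "q = n div k"
  define h where "h f = (\<lambda>j\<in>{..<n}. if j < q * k then c (j mod k) (f (j div k)) else 0)" for f :: "nat \<Rightarrow> 'v"
  let ?F = "{..<q} \<rightarrow>\<^sub>E D"
  have h: "h f (b * k + l) = c l (f b)" if "b < q" "l < k" for f b l
  proof -
    have "b * k + l < (b + 1) * k" using that by simp
    also have "\<dots> \<le> q * k" using that by (intro mult_right_mono) auto
    finally have lt: "b * k + l < q * k" .
    moreover have "q * k \<le> n" by (simp add: q_def)
    ultimately show ?thesis using that k by (simp add: h_def)
  qed
  have c0: "c l 0 = 0" for l using add[of l 0 0] by simp
  have minus: "c l (x - y) = c l x - c l y" for l x y using add[of l "x - y" y] by simp
  have inj: "inj_on h ?F"
  proof (rule inj_onI)
    fix f g assume f: "f \<in> ?F" and g: "g \<in> ?F" and eq: "h f = h g"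
    show "f = g"
    proof (rule PiE_ext[OF f g])
      fix b assume "b \<in> {..<q}"
      then have "c l (f b - g b) = 0" if "l < k" for l
        using h[of b l f] h[of b l g] that eq by (simp add: minus)
      then show "f b = g b" using faithful[of "f b - g b"] by simp
    qed
  qed
  have "cap_on n (h ` ?F)"
    unfolding cap_on_def
  proof (intro ballI impI)
    fix x y z assume "x \<in> h ` ?F" "y \<in> h ` ?F" "z \<in> h ` ?F" and sum0: "\<forall>i<n. x i + y i + z i = 0"
    then obtain f g g' where F: "f \<in> ?F" "g \<in> ?F" "g' \<in> ?F" and xyz: "x = h f" "y = h g" "z = h g'" by blast
    have "f b = g b \<and> g b = g' b" if b: "b < q" for b
    proof -
      have "c l (f b + g b + g' b) = 0" if l: "l < k" for l
      proof -
        have "b * k + l < (b + 1) * k" using l by simp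
        also have "\<dots> \<le> q * k" using b by (intro mult_right_mono) auto
        also have "\<dots> \<le> n" by (simp add: q_def)
        finally have "x (b * k + l) + y (b * k + l) + z (b * k + l) = 0" using sum0 by blast
        then show ?thesis by (simp add: xyz h[OF b l] add)
      qed
      then have "f b + g b + g' b = 0" by (rule faithful)
      moreover have "f b \<in> D" "g b \<in> D" "g' b \<in> D" using F b by auto
      ultimately show ?thesis using D(2) unfolding is_cap_def by blast
    qed
    then have "f = g" "g = g'" using PiE_ext[OF F(1,2)] PiE_ext[OF F(2,3)] by auto
    then show "x = y \<and> y = z" by (simp add: xyz)
  qed
  moreover have "h ` ?F \<subseteq> vecs n" by (intro image_subsetI) (simp add: h_def vecs_def)
  ultimately have "card (h ` ?F) \<le> r_ap 3 (Zmn 3 n)" by (intro cap_on_le_r_ap_3)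
  moreover have "card (h ` ?F) = card D ^ q" unfolding card_image[OF inj] by (simp add: card_PiE)
  ultimately show ?thesis by (simp add: q_def)
qed

lemma large_cap:
  obtains D :: "(9 \<Rightarrow> 8 \<Rightarrow> 6 \<Rightarrow> 3) set" where "is_cap D" "card D = 126 * ((8 * (12 * 112 ^ 7)) ^ 4 * (112 ^ 8) ^ 5)"
proof -
  obtain \<B> where "block_designs \<B>"
    using block_designs_exist ..
  then interpret block_designs \<B> .
  have t1: "x + x + x = 0" for x :: "6 \<Rightarrow> 3" by (intro ext) (simp only: plus_fun_apply zero_fun_apply triple_sum_3)
  have t2: "x + x + x = 0" for x :: "8 \<Rightarrow> 6 \<Rightarrow> 3" by (intro ext) (simp only: plus_fun_apply zero_fun_apply triple_sum_3)
  define L where "L = (one_hole_level (base_cap \<B>) :: _ \<Rightarrow> (8 \<Rightarrow> 6 \<Rightarrow> 3) set)"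
  have L: "extendable L" "finite (L l)" for l
    unfolding L_def by (rule extendable_one_hole_level[OF extendable_base_cap]) simp
  have cN: "card (L None) = 8 * (12 * 112 ^ 7)" and cS: "card (L (Some b)) = 112 ^ 8" for b
    unfolding L_def
    using card_one_hole_level_None[OF extendable_base_cap _ t1 card_base_cap_Some, where 'i = 8]
      card_one_hole_level_Some[OF extendable_base_cap _ t1 card_base_cap_Some, where 'i = 8]
    by (simp_all add: card_base_cap_None)
  obtain e :: "9 \<Rightarrow> nat" where e: "bij_betw e UNIV {0..<9}"
    using ex_bij_betw_finite_nat[of "UNIV :: 9 set"] by auto
  note adm = admissible_parity_T9[OF e]
  show thesis
  proof
    show "is_cap (\<Union>Z\<in>{Z. card Z = 4}. word_prod L (parity_word (\<lambda>p q. T9 (e p) (e q)) Z))"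
      by (rule is_cap_Union_word_prod[OF L(1) adm])
    have "(9::nat) choose 4 = 126" by (simp add: binomial_fact' fact_numeral)
    then show "card (\<Union>Z\<in>{Z. card Z = 4}. word_prod L (parity_word (\<lambda>p q. T9 (e p) (e q)) Z)) =
        126 * ((8 * (12 * 112 ^ 7)) ^ 4 * (112 ^ 8) ^ 5)"
      by (subst card_parity_level[OF L t2 cS adm]) (simp only: cN; simp)
  qed
qed

text \<open>The right side is 126 * 96^4 * 112^68. Comparing sixth powers keeps the evaluated
  numbers small: 0.9432 is slightly below 112 / 2.217^6, and 0.6263 slightly below 0.9432^8.\<close>

lemma power_2217_less: "(2.217::real) ^ 432 < 126 * ((8 * (12 * 112 ^ 7)) ^ 4 * (112 ^ 8) ^ 5)"
proof -
  have expand: "(x * y ^ 6) ^ 72 = (x ^ 8) ^ 9 * y ^ 432" "(8 * (12 * x ^ 7)) ^ 4 * (x ^ 8) ^ 5 = 96 ^ 4 * x ^ 68"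
    "x ^ 72 = x ^ 4 * x ^ 68" for x y :: real
    by (simp_all add: power_mult_distrib flip: power_mult power_add)
  have "(0.6263::real) ^ 9 * 2.217 ^ 432 \<le> (0.9432 ^ 8) ^ 9 * 2.217 ^ 432"
    by (intro mult_right_mono power_mono zero_le_power) (simp_all add: power_divide)
  also have "\<dots> = (0.9432 * 2.217 ^ 6) ^ 72" by (rule expand(1)[symmetric])
  also have "\<dots> \<le> 112 ^ 72" by (intro power_mono) (simp_all add: power_divide)
  also have "\<dots> = 112 ^ 4 * 112 ^ 68" by (rule expand(3))
  also have "\<dots> < (0.6263 ^ 9 * (126 * 96 ^ 4)) * 112 ^ 68" by (intro mult_strict_right_mono zero_less_power) (simp_all add: power_divide)
  also have "\<dots> = 0.6263 ^ 9 * (126 * ((8 * (12 * 112 ^ 7)) ^ 4 * (112 ^ 8) ^ 5))"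
    by (simp only: expand(2) mult.assoc)
  finally show ?thesis by (rule mult_left_less_imp_less) (intro zero_le_power, simp)
qed

theorem eventually_r_ap_3_ge: "\<forall>\<^sub>F n in sequentially. 2.217 ^ n \<le> real (r_ap 3 (Zmn 3 n))"
proof -
  obtain D :: "(9 \<Rightarrow> 8 \<Rightarrow> 6 \<Rightarrow> 3) set" where D: "is_cap D"
    "card D = 126 * ((8 * (12 * 112 ^ 7)) ^ 4 * (112 ^ 8) ^ 5)"
    by (rule large_cap)
  have "CARD(9 \<times> 8 \<times> 6) = 432" by simp
  then obtain e :: "nat \<Rightarrow> 9 \<times> 8 \<times> 6" where e: "bij_betw e {0..<432} UNIV"
    using ex_bij_betw_nat_finite[of "UNIV :: (9 \<times> 8 \<times> 6) set"] by auto
  define c where "c l g = (case e l of (a, b, d) \<Rightarrow> g a b d)" for l and g :: "9 \<Rightarrow> 8 \<Rightarrow> 6 \<Rightarrow> 3"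
  have power: "card D ^ (n div 432) \<le> r_ap 3 (Zmn 3 n)" for n
  proof (rule cap_power_le_r_ap_3)
    show "c l (x + y) = c l x + c l y" for l x y by (simp add: c_def split: prod.split)
    show "x = 0" if z: "\<And>l. l < 432 \<Longrightarrow> c l x = 0" for x
    proof -
      have "x a b d = 0" for a b d
      proof -
        have "(a, b, d) \<in> e ` {0..<432}" using bij_betw_imp_surj_on[OF e] by simp
        then obtain l where "(a, b, d) = e l" "l \<in> {0..<432}" by (rule imageE)
        then show ?thesis using z[of l] by (simp add: c_def flip: \<open>(a, b, d) = e l\<close>)
      qed
      then show ?thesis by (intro ext) (simp only: zero_fun_apply)
    qed
  qed (use D in auto)
  define N where "N = real (card D)"
  have N: "2.217 ^ 432 < N" using power_2217_less unfolding N_def D(2) by (simp only: of_nat_mult of_nat_power of_nat_numeral)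
  then have "0 < N" by (rule le_less_trans[rotated]) simp
  \<comment> \<open>The strict inequality \<open>2.217 ^ 432 < N\<close> absorbs the loss from
    rounding \<open>n\<close> down to a multiple of 432.\<close>
  have "\<forall>\<^sub>F n in sequentially. 1 * 2.217 ^ n * (1 / N) ^ (1 * (n div 432)) \<le> (1::real) ^ n"
    by (rule eventually_power_bound) (use N \<open>0 < N\<close> in \<open>simp_all only: power_one power_one_right, simp_all add: divide_less_eq\<close>)
  then show ?thesis
  proof eventually_elim
    case (elim n)
    have "2.217 ^ n \<le> N ^ (n div 432)" using elim \<open>0 < N\<close> by (simp add: power_divide divide_le_eq mult.commute)
    also have "\<dots> = real (card D ^ (n div 432))" by (simp add: N_def)
    also have "\<dots> \<le> real (r_ap 3 (Zmn 3 n))" using power of_nat_le_iff by blast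
    finally show ?case .
  qed
qed

theorem theorem1p2:
  shows "\<exists>N::nat. \<forall>n::nat. n \<ge> N \<and> n > 0 \<longrightarrow>
    (4.434::real) ^ n \<le> real (2 ^ n * r_ap 3 (Zmn 3 n)) \<and>
    2 ^ n * r_ap 3 (Zmn 3 n) \<le> r_ap 6 (Zmn 6 n) \<and>
    real (r_ap 6 (Zmn 6 n)) \<le> (5.709::real) ^ n"
proof -
  have "\<forall>\<^sub>F n in sequentially. 2.217 ^ n \<le> real (r_ap 3 (Zmn 3 n)) \<and> real (r_ap 6 (Zmn 6 n)) \<le> (5.709::real) ^ n"
    using eventually_r_ap_3_ge eventually_r_ap_6_le by (rule eventually_conj)
  then obtain N where N: "\<And>n. n \<ge> N \<Longrightarrow> 2.217 ^ n \<le> real (r_ap 3 (Zmn 3 n)) \<and> real (r_ap 6 (Zmn 6 n)) \<le> (5.709::real) ^ n"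
    unfolding eventually_sequentially by blast
  have "(4.434::real) ^ n \<le> real (2 ^ n * r_ap 3 (Zmn 3 n))" if "n \<ge> N" for n
  proof -
    have "(4.434::real) ^ n = 2 ^ n * 2.217 ^ n" by (simp flip: power_mult_distrib)
    also have "\<dots> \<le> 2 ^ n * real (r_ap 3 (Zmn 3 n))" using N[OF that] by simp
    finally show ?thesis by simp
  qed
  then show ?thesis using N r_ap_6_ge by blast
qed

end
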